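(* Let $m$ be a quasi-Bernoulli measure on $[0,1)^D$ with dimension $d=-\tau'(1)$, and let $\chi(q)=\tau(1-q)-qd$. Suppose that there exists a constant $C>0$ such that $$\forall q\in(0,1],\quad 0<\chi(q)\le C\,\chi(q/2).$$ Then, $m$-almost surely, $$\limsup_{n\to+\infty}\frac{S_n-nd}{\theta(n)}\ge1,$$ where $\theta(t)=\frac{1}{\chi^{-1}(1/t)}$ (for $t\ge 1/\chi(1)$) and $\chi^{-1}$ is the inverse function of $\chi:[0,1]\to[0,\chi(1)]$, defined on $[0,\chi(1)]$. As a consequence, for all $0<a<1$, $$m\ll\widehat{\mathcal P}^{\psi_a},\quad\text{where }\psi_a(t)=t^d\,\ell^{-a\theta(\log_\ell(1/t))}\ (t>0\text{ small}).$$ In particular, $m$ is absolutely continuous with respect to $\widehat{\mathcal P}^d$.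
   Context: Fix integers $D\ge1$, $\ell\ge2$. $\mathcal F_n$ is the family of $\ell$-adic cubes $\prod_{i=1}^D[k_i/\ell^n,(k_i+1)/\ell^n)$, $0\le k_i<\ell^n$. For each $n$ the cubes of $\mathcal F_n$ are coded bijectively as $I_{\varepsilon_1\cdots\varepsilon_n}$, $\varepsilon_i\in\{0,\dots,\ell^D-1\}$, with $I_{\varepsilon_1\cdots\varepsilon_{n+1}}\subset I_{\varepsilon_1\cdots\varepsilon_n}$. For $I=I_{\varepsilon_1\cdots\varepsilon_n}\in\mathcal F_n$ and $J=I_{\varepsilon_{n+1}\cdots\varepsilon_{n+p}}\in\mathcal F_p$, let $IJ=I_{\varepsilon_1\cdots\varepsilon_{n+p}}\in\mathcal F_{n+p}$. A Borel probability measure $m$ on $[0,1)^D$ is quasi-Bernoulli if there is a constant $C\ge1$ with $\frac1Cm(I)m(J)\le m(IJ)\le C\,m(I)m(J)$ for all $I,J\in\bigcup_n\mathcal F_n$. The $L^q$-spectrum is $\tau(q)=\limsup_{n\to\infty}\frac{1}{n\log\ell}\log\left(\sum_{I\in\mathcal F_n}m(I)^q\right)$, $q\in\mathbb R$ (sum over cubes with $m(I)>0$). For quasi-Bernoulli $m$ it is known that $\tau$ is convex and $C^1$ on $\mathbb R$, and that $d=-\tau'(1)$ is the dimension of $m$. $I_n(x)$ is the cube of $\mathcal F_n$ containing $x$, and $S_n(x)=-\log_\ell m(I_n(x))$. Generalized packing measure: for a positive function $\Psi$ defined for small $t>0$, the packing pre-measure is $\mathcal P^\Psi(E)=\lim_{\eta\to0}\sup\{\sum_i\Psi(|B_i|)\}$,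 the supremum being over countable families of pairwise disjoint balls $B_i$ centered in $E$ with $0<|B_i|\le\eta$ ($|B|$ the diameter), and the packing measure is $\widehat{\mathcal P}^\Psi(E)=\inf\{\sum_i\mathcal P^\Psi(E_i):E\subset\bigcup_iE_i\}$ (countable covers). $\widehat{\mathcal P}^s$ denotes $\widehat{\mathcal P}^\Psi$ with $\Psi(t)=t^s$. $m\ll\widehat{\mathcal P}^\Psi$ means: $\widehat{\mathcal P}^\Psi(E)=0$ implies $m(E)=0$ for every Borel set $E$. *)

theory Defs
  imports "HOL-Probability.Probability"
begin

section \<open>Adic cubes and quasi-Bernoulli measures\<close>

text \<open>The dimension \<open>D\<close> is \<open>CARD('n)\<close>, with \<open>'n\<close> a finite index type.\<close>

definition unit_box :: "(real ^ 'n) set" where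
  "unit_box = {x. \<forall>i. 0 \<le> x $ i \<and> x $ i < 1}"

definition adic_cube :: "nat \<Rightarrow> nat \<Rightarrow> ('n \<Rightarrow> nat) \<Rightarrow> (real ^ 'n) set" where
  "adic_cube l n k =
     {x. \<forall>i. real (k i) / real l ^ n \<le> x $ i \<and> x $ i < (real (k i) + 1) / real l ^ n}"

definition adic_cubes :: "nat \<Rightarrow> nat \<Rightarrow> (real ^ 'n) set set" where
  "adic_cubes l n = adic_cube l n ` {k. \<forall>i. k i < l ^ n}"

definition adic_words :: "nat \<Rightarrow> nat \<Rightarrow> nat list set" where
  "adic_words D l = {w. set w \<subseteq> {..<l ^ D}}"

text \<open>A coding maps the word \<open>[\<epsilon>\<^sub>1, \<dots>, \<epsilon>\<^sub>n]\<close> to the cube with that code. The empty word is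
  necessarily sent to the unit box, the only cube of generation 0.\<close>

definition adic_coding :: "nat \<Rightarrow> (nat list \<Rightarrow> (real ^ 'n) set) \<Rightarrow> bool" where
  "adic_coding l c \<longleftrightarrow>
     (\<forall>n. bij_betw c {w \<in> adic_words CARD('n) l. length w = n} (adic_cubes l n)) \<and>
     (\<forall>w \<epsilon>. w @ [\<epsilon>] \<in> adic_words CARD('n) l \<longrightarrow> c (w @ [\<epsilon>]) \<subseteq> c w)"

text \<open>Since \<open>c\<close> is bijective in each generation, the cubes \<open>I\<close> and \<open>J\<close> are given by their words
  \<open>u\<close> and \<open>v\<close>, and \<open>IJ\<close> is the cube coded by the concatenation \<open>u @ v\<close>.\<close>

definition quasi_Bernoulli ::
    "nat \<Rightarrow> (nat list \<Rightarrow> (real ^ 'n) set) \<Rightarrow> (real ^ 'n) measure \<Rightarrow> bool" where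
  "quasi_Bernoulli l c m \<longleftrightarrow>
     prob_space m \<and> sets m = sets (restrict_space borel unit_box) \<and>
     (\<exists>C\<ge>1. \<forall>u \<in> adic_words CARD('n) l. \<forall>v \<in> adic_words CARD('n) l.
        1 / C * measure m (c u) * measure m (c v) \<le> measure m (c (u @ v)) \<and>
        measure m (c (u @ v)) \<le> C * measure m (c u) * measure m (c v))"

section \<open>The spectrum, the dimension, and the functions \<open>\<chi>\<close>, \<open>\<theta>\<close>, \<open>\<psi>\<^sub>a\<close>\<close>

text \<open>The limsup is taken in the extended reals; for quasi-Bernoulli measures it is finite.\<close>

definition Lq_spectrum :: "nat \<Rightarrow> (real ^ 'n) measure \<Rightarrow> real \<Rightarrow> real" where
  "Lq_spectrum l m q = real_of_ereal (limsup (\<lambda>n. ereal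
     (1 / (real n * ln (real l)) *
       ln (\<Sum>I \<in> {I \<in> adic_cubes l n. measure m I > 0}. measure m I powr q))))"

definition qB_dim :: "nat \<Rightarrow> (real ^ 'n) measure \<Rightarrow> real" where
  "qB_dim l m = - deriv (Lq_spectrum l m) 1"

definition chi :: "nat \<Rightarrow> (real ^ 'n) measure \<Rightarrow> real \<Rightarrow> real" where
  "chi l m q = Lq_spectrum l m (1 - q) - q * qB_dim l m"

text \<open>Only meaningful for \<open>t \<ge> 1 / chi l m 1\<close>, when \<open>chi l m\<close> is a bijection from \<open>[0, 1]\<close> onto
  \<open>[0, chi l m 1]\<close>. Accordingly \<open>psi\<close> is only meaningful for small \<open>t > 0\<close>.\<close>

definition theta :: "nat \<Rightarrow> (real ^ 'n) measure \<Rightarrow> real \<Rightarrow> real" where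
  "theta l m t = 1 / the_inv_into {0..1} (chi l m) (1 / t)"

definition psi :: "nat \<Rightarrow> (real ^ 'n) measure \<Rightarrow> real \<Rightarrow> real \<Rightarrow> real" where
  "psi l m a t = t powr qB_dim l m * real l powr (- a * theta l m (log (real l) (1 / t)))"

definition cube_at :: "nat \<Rightarrow> nat \<Rightarrow> real ^ 'n \<Rightarrow> (real ^ 'n) set" where
  "cube_at l n x = (THE I. I \<in> adic_cubes l n \<and> x \<in> I)"

definition S_n :: "nat \<Rightarrow> (real ^ 'n) measure \<Rightarrow> nat \<Rightarrow> real ^ 'n \<Rightarrow> real" where
  "S_n l m n x = - log (real l) (measure m (cube_at l n x))"

section \<open>Packing measures\<close>

text \<open>Balls are closed Euclidean balls of the ambient space. As they are nonempty and pairwise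
  disjoint, a family of balls is the same thing as a set of balls.\<close>

definition packings :: "real \<Rightarrow> 'a::euclidean_space set \<Rightarrow> 'a set set set" where
  "packings \<eta> E = {\<B>. countable \<B> \<and> disjoint \<B> \<and>
     (\<forall>B \<in> \<B>. (\<exists>x \<in> E. \<exists>r. B = cball x r) \<and> 0 < diameter B \<and> diameter B \<le> \<eta>)}"

text \<open>The gauge \<open>\<Psi>\<close> matters only near \<open>0\<close>, where it is meant to be positive.\<close>

definition packing_sup :: "(real \<Rightarrow> real) \<Rightarrow> real \<Rightarrow> 'a::euclidean_space set \<Rightarrow> ennreal" where
  "packing_sup \<Psi> \<eta> E = (SUP \<B> \<in> packings \<eta> E. \<Sum>\<^sub>\<infinity>B\<in>\<B>. ennreal (\<Psi> (diameter B)))"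

definition packing_premeasure :: "(real \<Rightarrow> real) \<Rightarrow> 'a::euclidean_space set \<Rightarrow> ennreal" where
  "packing_premeasure \<Psi> E = Lim (at_right 0) (\<lambda>\<eta>. packing_sup \<Psi> \<eta> E)"

definition packing_measure :: "(real \<Rightarrow> real) \<Rightarrow> 'a::euclidean_space set \<Rightarrow> ennreal" where
  "packing_measure \<Psi> E =
     (INF A \<in> {A :: nat \<Rightarrow> 'a set. E \<subseteq> (\<Union>i. A i)}. \<Sum>i. packing_premeasure \<Psi> (A i))"

definition abs_cont_packing :: "'a::euclidean_space measure \<Rightarrow> (real \<Rightarrow> real) \<Rightarrow> bool" where
  "abs_cont_packing m \<Psi> \<longleftrightarrow> (\<forall>E \<in> sets m. packing_measure \<Psi> E = 0 \<longrightarrow> emeasure m E = 0)"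

text \<open>The limit defining the pre-measure always exists, by monotonicity in \<open>\<eta>\<close>.\<close>

lemma packing_sup_mono: "\<eta> \<le> \<eta>' \<Longrightarrow> packing_sup \<Psi> \<eta> E \<le> packing_sup \<Psi> \<eta>' E"
  unfolding packing_sup_def packings_def by (rule SUP_subset_mono) fastforce+

lemma packing_premeasure_eq_INF:
  "packing_premeasure \<Psi> E = (INF \<eta> \<in> {0<..}. packing_sup \<Psi> \<eta> E)"
proof -
  have "((\<lambda>\<eta>. packing_sup \<Psi> \<eta> E) \<longlongrightarrow> (INF \<eta> \<in> {0<..}. packing_sup \<Psi> \<eta> E)) (at_right 0)"
  proof (rule order_tendstoI)
    fix y assume "y < (INF \<eta> \<in> {0<..}. packing_sup \<Psi> \<eta> E)"
    then have "y < packing_sup \<Psi> \<eta> E" if "\<eta> > 0" for \<eta>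
      using that by (auto intro: less_le_trans INF_lower)
    then show "\<forall>\<^sub>F \<eta> in at_right 0. y < packing_sup \<Psi> \<eta> E"
      by (auto simp: eventually_at_filter)
  next
    fix y assume "(INF \<eta> \<in> {0<..}. packing_sup \<Psi> \<eta> E) < y"
    then obtain \<eta> where "\<eta> > 0" "packing_sup \<Psi> \<eta> E < y"
      by (auto simp: INF_less_iff)
    then show "\<forall>\<^sub>F \<eta> in at_right 0. packing_sup \<Psi> \<eta> E < y"
      unfolding eventually_at_right_field
      by (meson le_less_trans less_imp_le packing_sup_mono)
  qed
  then show ?thesis
    unfolding packing_premeasure_def by (intro tendsto_Lim) auto
qed

end

theory Submission
  imports Defs
begin

text \<open>The starting point is that quasi-Bernoulli measures have exponential moments of \<open>S_n - n d\<close> known up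
  to a constant: the sums \<open>Z n s\<close> of \<open>m(I) powr s\<close> over the cubes of generation \<open>n\<close> are
  multiplicative up to \<open>C\<close>, so \<open>log Z n s\<close> differs from \<open>n \<tau>(s)\<close> by a bounded amount, and the
  \<open>m\<close>-mean of \<open>l powr (q (S_n - n d))\<close> is comparable to \<open>l powr (n \<chi>(q))\<close>, uniformly in \<open>n\<close> and in
  \<open>0 \<le> q \<le> 1\<close> (lemma \<open>moment_bounds\<close>).

  The scale \<open>\<theta>(n)\<close> is chosen so that \<open>n \<chi>(1 / \<theta>(n)) = 1\<close>. Take \<open>q = M / \<theta>(n)\<close> with a large
  constant \<open>M\<close>. Convexity gives \<open>n \<chi>(q) \<ge> M\<close>, and the doubling condition bounds \<open>n \<chi>(2 q)\<close> by a
  constant, so that the Paley--Zygmund inequality shows \<open>S_n - n d \<ge> (1 - O(1 / M)) \<theta>(n)\<close> with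
  probability bounded below (\<open>heavy_words\<close>). By the quasi-Bernoulli property this also holds
  conditionally on each cube, with one lower bound for all cubes (\<open>heavy_words_in_cube\<close>). A set that
  occupies a fixed proportion of every cube has full measure (\<open>AE_if_dense_in_cubes\<close>). Therefore, for
  each \<open>b < 1\<close>, almost every point satisfies \<open>S_n - n d \<ge> b \<theta>(n)\<close> infinitely often, which is the
  statement on the upper limit.

  For the packing measures, light cubes have to be replaced by light balls. A cube may be much lighter
  than the cubes around it, but by the Borel--Cantelli lemma almost every point eventually lies in cubes
  whose surroundings are at most \<open>n\<^sup>2\<close> times heavier (\<open>AE_eventually_ball_le_cube\<close>). The doubling
  condition makes \<open>\<theta>(n)\<close> grow at least like a power of \<open>n\<close>, so that the loss of \<open>n\<^sup>2\<close> is paid for by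
  lowering \<open>b\<close> to \<open>a\<close> in the exponent. Vitali's covering lemma turns the light balls into packings, and
  absolute continuity follows (\<open>abs_cont_packing_if_balls_frequently_light\<close>). The gauge
  \<open>t powr d\<close> is larger than \<open>\<psi>\<^sub>a\<close> at small \<open>t\<close> of the form \<open>1 / l ^ n\<close>, so it inherits the
  conclusion.\<close>

section \<open>Quasi-additive sequences, logarithmic convexity, second moments\<close>

text \<open>Fekete's argument, run from both sides: \<open>a + k\<close> is subadditive and \<open>a - k\<close> is superadditive, so
  every quotient \<open>(a n - k) / n\<close> lies below every quotient \<open>(a p + k) / p\<close>, as comparing both at
  the common multiple \<open>n p\<close> shows. Any \<open>L\<close> that separates the two families works.\<close>

lemma quasi_additive_imp_linear:
  fixes a :: "nat \<Rightarrow> real"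
  assumes "\<And>n p. \<bar>a (n + p) - a n - a p\<bar> \<le> k"
  obtains L where "\<And>n. \<bar>a n - real n * L\<bar> \<le> k"
proof -
  have upper: "a (p * n) + k \<le> real p * (a n + k)" if "p \<ge> 1" for n p
    using that
  proof (induction p rule: dec_induct)
    case (step p)
    then show ?case
      using assms[of n "p * n"] by (auto simp: algebra_simps abs_le_iff)
  qed simp
  have lower: "real p * (a n - k) \<le> a (p * n) - k" if "p \<ge> 1" for n p
    using that
  proof (induction p rule: dec_induct)
    case (step p)
    then show ?case
      using assms[of n "p * n"] by (auto simp: algebra_simps abs_le_iff)
  qed simp
  have k: "k \<ge> 0"
    using assms[of 0 0] by simp
  have cross: "(a n - k) / real n \<le> (a p + k) / real p" if "n \<ge> 1" "p \<ge> 1" for n p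
  proof -
    have "real p * (a n - k) \<le> real n * (a p + k)"
      using lower[of p n] upper[of n p] that k by (simp add: mult.commute)
    then show ?thesis
      using that by (simp add: field_simps)
  qed
  define L where "L = (SUP n\<in>{1..}. (a n - k) / real n)"
  have bdd: "bdd_above ((\<lambda>n. (a n - k) / real n) ` {1..})"
    using cross[of _ 1] by (auto intro!: bdd_aboveI)
  have "\<bar>a n - real n * L\<bar> \<le> k" if n: "n \<ge> 1" for n
  proof -
    have "(a n - k) / real n \<le> L"
      unfolding L_def using n bdd by (intro cSUP_upper) auto
    moreover have "L \<le> (a n + k) / real n"
      unfolding L_def using n cross by (intro cSUP_least) auto
    ultimately show ?thesis
      using n by (simp add: field_simps abs_le_iff)
  qed
  moreover have "\<bar>a 0 - real 0 * L\<bar> \<le> k"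
    using assms[of 0 0] by simp
  ultimately show ?thesis
    using that by (metis less_one not_less)
qed

lemma linear_up_to_const_imp_tendsto:
  fixes a :: "nat \<Rightarrow> real"
  assumes "\<And>n. \<bar>a n - real n * L\<bar> \<le> k"
  shows "(\<lambda>n. a n / real n) \<longlonglongrightarrow> L"
proof (rule LIM_zero_cancel, rule Lim_null_comparison)
  show "\<forall>\<^sub>F n in sequentially. norm (a n / real n - L) \<le> k / real n"
  proof (rule eventually_mono[OF eventually_gt_at_top[of 0]])
    fix n :: nat assume "0 < n"
    then have "a n / real n - L = (a n - real n * L) / real n"
      by (simp add: field_simps)
    then show "norm (a n / real n - L) \<le> k / real n"
      using assms[of n] by (simp add: divide_right_mono)
  qed
  show "(\<lambda>n. k / real n) \<longlonglongrightarrow> 0"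
    by (rule lim_const_over_n)
qed

text \<open>This is Hoelder's inequality. After dividing by \<open>Z x powr (1 - t) * Z y powr t\<close> it follows term by
  term from the convexity of the exponential function. Terms with \<open>f w = 0\<close> contribute nothing for
  any exponent, because \<open>0 powr s = 0\<close>.\<close>

lemma convex_on_ln_sum_powr:
  fixes f :: "'a \<Rightarrow> real"
  assumes fin: "finite A" and nonneg: "\<And>w. w \<in> A \<Longrightarrow> 0 \<le> f w"
    and pos: "\<exists>w\<in>A. 0 < f w" and S: "convex S"
  shows "convex_on S (\<lambda>s. ln (\<Sum>w\<in>A. f w powr s))"
proof (rule convex_onI)
  fix t x y :: real
  assume t: "0 < t" "t < 1"
  define Z where "Z s = (\<Sum>w\<in>A. f w powr s)" for s
  have Z_pos: "0 < Z s" for s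
  proof -
    obtain w where "w \<in> A" "0 < f w"
      using pos by blast
    then show ?thesis
      unfolding Z_def using fin by (intro sum_pos2[of A w]) auto
  qed
  define z where "z = (1 - t) * x + t * y"
  have term_le: "f w powr z / (Z x powr (1 - t) * Z y powr t)
      \<le> (1 - t) * (f w powr x / Z x) + t * (f w powr y / Z y)" if "w \<in> A" for w
  proof (cases "f w = 0")
    case False
    then have fw: "0 < f w"
      using nonneg[OF that] by simp
    have "exp ((1 - t) * (x * ln (f w) - ln (Z x)) + t * (y * ln (f w) - ln (Z y)))
        \<le> (1 - t) * exp (x * ln (f w) - ln (Z x)) + t * exp (y * ln (f w) - ln (Z y))"
      using convex_onD[OF exp_convex, of t "x * ln (f w) - ln (Z x)" "y * ln (f w) - ln (Z y)"] t
      by simp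
    moreover have "exp (s * ln (f w) - ln (Z s)) = f w powr s / Z s" for s
      using fw Z_pos[of s] by (simp add: exp_diff powr_def)
    moreover have "(1 - t) * (x * ln (f w) - ln (Z x)) + t * (y * ln (f w) - ln (Z y))
        = z * ln (f w) - ((1 - t) * ln (Z x) + t * ln (Z y))"
      by (simp add: z_def algebra_simps)
    moreover have "exp (z * ln (f w) - ((1 - t) * ln (Z x) + t * ln (Z y)))
        = f w powr z / (Z x powr (1 - t) * Z y powr t)"
      using fw Z_pos[of x] Z_pos[of y] by (simp add: exp_diff exp_add powr_def)
    ultimately show ?thesis
      by simp
  qed (use t Z_pos in simp)
  have "Z z / (Z x powr (1 - t) * Z y powr t)
      = (\<Sum>w\<in>A. f w powr z / (Z x powr (1 - t) * Z y powr t))"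
    by (simp add: Z_def sum_divide_distrib)
  also have "\<dots> \<le> (\<Sum>w\<in>A. (1 - t) * (f w powr x / Z x) + t * (f w powr y / Z y))"
    by (intro sum_mono term_le)
  also have "\<dots> = (1 - t) * (Z x / Z x) + t * (Z y / Z y)"
    by (simp only: Z_def sum.distrib sum_divide_distrib sum_distrib_left)
  also have "\<dots> = 1"
    using Z_pos[of x] Z_pos[of y] by simp
  finally have "Z z \<le> Z x powr (1 - t) * Z y powr t"
    using Z_pos[of x] Z_pos[of y] by (simp add: field_simps)
  then have "ln (Z z) \<le> ln (Z x powr (1 - t) * Z y powr t)"
    by (meson Z_pos less_le_trans ln_le_cancel_iff)
  also have "\<dots> = (1 - t) * ln (Z x) + t * ln (Z y)"
    using Z_pos[of x] Z_pos[of y] by (simp add: ln_mult ln_powr)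
  finally show "ln (\<Sum>w\<in>A. f w powr ((1 - t) *\<^sub>R x + t *\<^sub>R y))
      \<le> (1 - t) * ln (\<Sum>w\<in>A. f w powr x) + t * ln (\<Sum>w\<in>A. f w powr y)"
    by (simp add: Z_def z_def)
qed (use S in auto)

text \<open>A second moment bound that turns a large mean of \<open>Y\<close> into a set of substantial weight on which
  \<open>Y\<close> is large: discarding \<open>Y < a\<close> costs at most \<open>a\<close>, half of the mean, and Cauchy--Schwarz bounds
  what remains by the weight of the set times the second moment.\<close>

lemma Paley_Zygmund_sum:
  fixes p Y :: "'a \<Rightarrow> real"
  assumes fin: "finite A" and p: "\<And>w. w \<in> A \<Longrightarrow> 0 \<le> p w" and p_le: "sum p A \<le> 1"
    and a: "0 \<le> a" "2 * a \<le> (\<Sum>w\<in>A. p w * Y w)"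
    and b: "0 < b" "(\<Sum>w\<in>A. p w * (Y w)\<^sup>2) \<le> b"
  shows "a\<^sup>2 / b \<le> (\<Sum>w | w \<in> A \<and> a \<le> Y w. p w)"
proof -
  define T where "T = {w \<in> A. a \<le> Y w}"
  have T: "T \<subseteq> A" "finite T"
    using fin by (auto simp: T_def)
  have "(\<Sum>w\<in>A - T. p w * Y w) \<le> (\<Sum>w\<in>A - T. p w * a)"
    using p by (intro sum_mono mult_left_mono) (auto simp: T_def)
  also have "\<dots> = a * (\<Sum>w\<in>A - T. p w)"
    by (simp add: sum_distrib_left mult.commute)
  also have "\<dots> \<le> a * 1"
    using sum_mono2[of A "A - T" p] fin p p_le a by (intro mult_left_mono) auto
  finally have "a \<le> (\<Sum>w\<in>T. p w * Y w)"
    using a(2) sum.subset_diff[OF T(1) fin, of "\<lambda>w. p w * Y w"] by simp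
  then have "a\<^sup>2 \<le> (\<Sum>w\<in>T. p w * Y w)\<^sup>2"
    using a by (intro power_mono) auto
  also have "\<dots> = (\<Sum>w\<in>T. sqrt (p w) * (sqrt (p w) * Y w))\<^sup>2"
    using p T by (intro arg_cong[where f="\<lambda>x. x\<^sup>2"] sum.cong) (auto simp: mult.assoc[symmetric])
  also have "\<dots> \<le> (\<Sum>w\<in>T. (sqrt (p w))\<^sup>2) * (\<Sum>w\<in>T. (sqrt (p w) * Y w)\<^sup>2)"
    by (rule Cauchy_Schwarz_ineq_sum)
  also have "\<dots> = (\<Sum>w\<in>T. p w) * (\<Sum>w\<in>T. p w * (Y w)\<^sup>2)"
    using p T by (intro arg_cong2[where f="(*)"] sum.cong) (auto simp: power_mult_distrib)
  also have "\<dots> \<le> (\<Sum>w\<in>T. p w) * b"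
  proof (intro mult_left_mono)
    show "(\<Sum>w\<in>T. p w * (Y w)\<^sup>2) \<le> b"
      using sum_mono2[OF fin T(1), of "\<lambda>w. p w * (Y w)\<^sup>2"] p b by auto
  qed (use p T in \<open>auto intro: sum_nonneg\<close>)
  finally show ?thesis
    using b by (simp add: T_def field_simps)
qed

section \<open>Balls of small mass and packing measures\<close>

lemma emeasure_UN_le_infsum:
  assumes "countable C" and sets: "\<And>i. i \<in> C \<Longrightarrow> U i \<in> sets M"
    and le: "\<And>i. i \<in> C \<Longrightarrow> emeasure M (U i) \<le> g i"
  shows "emeasure M (\<Union>i\<in>C. U i) \<le> (\<Sum>\<^sub>\<infinity>i\<in>C. g i)"
proof -
  define F where "F n = {i \<in> C. to_nat_on C i < n}" for n
  have F: "finite (F n)" "F n \<subseteq> C" for n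
  proof -
    have "inj_on (to_nat_on C) (F n)"
      using inj_on_to_nat_on[OF \<open>countable C\<close>] by (rule inj_on_subset) (auto simp: F_def)
    moreover have "finite (to_nat_on C ` F n)"
      by (rule finite_subset[of _ "{..<n}"]) (auto simp: F_def)
    ultimately show "finite (F n)"
      by (simp add: finite_image_iff)
  qed (auto simp: F_def)
  have "emeasure M (\<Union>i\<in>F n. U i) \<le> (\<Sum>\<^sub>\<infinity>i\<in>C. g i)" for n
  proof -
    have "emeasure M (\<Union>i\<in>F n. U i) \<le> (\<Sum>i\<in>F n. emeasure M (U i))"
      using F[of n] sets by (intro emeasure_subadditive_finite) auto
    also have "\<dots> \<le> (\<Sum>i\<in>F n. g i)"
      using F[of n] le by (intro sum_mono) auto
    also have "\<dots> \<le> (\<Sum>\<^sub>\<infinity>i\<in>C. g i)"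
      using F[of n] by (subst nonneg_infsum_complete) (auto intro!: SUP_upper)
    finally show ?thesis .
  qed
  moreover have "(SUP n. emeasure M (\<Union>i\<in>F n. U i)) = emeasure M (\<Union>n. \<Union>i\<in>F n. U i)"
  proof (intro SUP_emeasure_incseq)
    show "range (\<lambda>n. \<Union>i\<in>F n. U i) \<subseteq> sets M"
      using F sets by (fastforce intro!: sets.finite_UN)
    show "incseq (\<lambda>n. \<Union>i\<in>F n. U i)"
      by (auto simp: incseq_def F_def)
  qed
  moreover have "(\<Union>n. \<Union>i\<in>F n. U i) = (\<Union>i\<in>C. U i)"
    by (auto simp: F_def)
  ultimately show ?thesis
    by (metis SUP_least)
qed

text \<open>If every point of \<open>A\<close> is the centre of small balls whose fivefold enlargement has mass at most
  \<open>\<Psi>\<close> of the diameter, Vitali's covering lemma selects disjoint balls whose enlargements still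
  cover \<open>A\<close>. The selected balls are a packing, and their \<open>\<Psi>\<close>-sum dominates the mass of the cover.
  As \<open>A\<close> may fail to be measurable, its mass is expressed by a measurable superset.\<close>

lemma Vitali_cover_packing_sup:
  fixes m :: "'a::euclidean_space measure"
  assumes X: "\<And>x r. cball x r \<inter> X \<in> sets m" and "A \<subseteq> X" and \<eta>: "0 < \<eta>"
    and light: "\<And>x. x \<in> A \<Longrightarrow>
      \<exists>\<^sub>F r in at_right 0. emeasure m (cball x (5 * r) \<inter> X) \<le> ennreal (\<Psi> (2 * r))"
    and "A \<subseteq> E"
  shows "\<exists>U\<in>sets m. A \<subseteq> U \<and> emeasure m U \<le> packing_sup \<Psi> \<eta> E"
proof -
  have "\<exists>r. 0 < r \<and> 2 * r \<le> \<eta> \<and> emeasure m (cball x (5 * r) \<inter> X) \<le> ennreal (\<Psi> (2 * r))"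
    if "x \<in> A" for x
  proof -
    have "eventually (\<lambda>r. 0 < r \<and> 2 * r \<le> \<eta>) (at_right (0::real))"
      using eventually_at_right_real[of 0 "\<eta> / 2"] \<eta> by (auto elim!: eventually_mono)
    then show ?thesis
      using frequently_ex[OF frequently_eventually_conj[OF light[OF that]]] by blast
  qed
  then obtain r where r: "\<And>x. x \<in> A \<Longrightarrow> 0 < r x" "\<And>x. x \<in> A \<Longrightarrow> 2 * r x \<le> \<eta>"
    "\<And>x. x \<in> A \<Longrightarrow> emeasure m (cball x (5 * r x) \<inter> X) \<le> ennreal (\<Psi> (2 * r x))"
    by metis
  have cover: "A \<subseteq> (\<Union>x\<in>A. cball x (r x))"
    using r(1) by (force simp: less_imp_le)
  have r_bound: "0 < r x \<and> r x \<le> \<eta>" if "x \<in> A" for x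
    using r(1,2)[OF that] by linarith
  obtain C where C: "countable C" "C \<subseteq> A"
    "pairwise (\<lambda>x y. disjnt (cball x (r x)) (cball y (r y))) C"
    "A \<subseteq> (\<Union>x\<in>C. cball x (5 * r x))"
    by (rule Vitali_covering_lemma_cballs[where a="\<lambda>x. x", OF cover r_bound])
  define h where "h x = cball x (r x)" for x
  have r_pos: "0 < r x" if "x \<in> C" for x
    using r(1) C(2) that by auto
  have inj: "inj_on h C"
  proof (rule inj_onI, rule ccontr)
    fix x y assume xy: "x \<in> C" "y \<in> C" "h x = h y" "x \<noteq> y"
    then have "disjnt (h x) (h y)"
      using pairwiseD[OF C(3), of x y] by (simp add: h_def)
    moreover have "x \<in> h x" "x \<in> h y"
      using r_pos[OF xy(1)] xy(3) by (auto simp: h_def)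
    ultimately show False
      by (auto simp: disjnt_def)
  qed
  have "disjoint (h ` C)"
    using C(3) by (intro pairwise_imageI) (simp add: pairwise_def h_def)
  moreover have "(\<exists>x\<in>E. \<exists>r. B = cball x r) \<and> 0 < diameter B \<and> diameter B \<le> \<eta>" if B: "B \<in> h ` C" for B
  proof -
    obtain x where x: "x \<in> C" "B = cball x (r x)"
      using B unfolding h_def by blast
    then show ?thesis
      using r_pos[OF x(1)] r(2)[of x] C(2) \<open>A \<subseteq> E\<close> by (auto simp: diameter_cball)
  qed
  ultimately have packing: "h ` C \<in> packings \<eta> E"
    using C(1) unfolding packings_def by blast
  let ?U = "\<Union>x\<in>C. cball x (5 * r x) \<inter> X"
  have "emeasure m ?U \<le> (\<Sum>\<^sub>\<infinity>x\<in>C. ennreal (\<Psi> (2 * r x)))"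
    using C r(3) X by (intro emeasure_UN_le_infsum) auto
  also have "\<dots> = (\<Sum>\<^sub>\<infinity>x\<in>C. ennreal (\<Psi> (diameter (h x))))"
    using r_pos by (intro infsum_cong) (auto simp: h_def diameter_cball less_imp_le dest: less_asym)
  also have "\<dots> = (\<Sum>\<^sub>\<infinity>B\<in>h ` C. ennreal (\<Psi> (diameter B)))"
    by (subst infsum_reindex[OF inj]) (simp add: o_def)
  also have "\<dots> \<le> packing_sup \<Psi> \<eta> E"
    unfolding packing_sup_def by (rule SUP_upper[OF packing])
  finally have "emeasure m ?U \<le> packing_sup \<Psi> \<eta> E" .
  moreover have "?U \<in> sets m"
    using C(1) X by (intro sets.countable_UN') auto
  moreover have "A \<subseteq> ?U"
    using C(4) \<open>A \<subseteq> X\<close> by blast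
  ultimately show ?thesis
    by blast
qed

lemma Vitali_cover_packing_premeasure:
  fixes m :: "'a::euclidean_space measure"
  assumes X: "\<And>x r. cball x r \<inter> X \<in> sets m" and "A \<subseteq> X"
    and light: "\<And>x. x \<in> A \<Longrightarrow>
      \<exists>\<^sub>F r in at_right 0. emeasure m (cball x (5 * r) \<inter> X) \<le> ennreal (\<Psi> (2 * r))"
    and "A \<subseteq> E"
  shows "\<exists>U\<in>sets m. A \<subseteq> U \<and> emeasure m U \<le> packing_premeasure \<Psi> E"
proof -
  have "\<exists>U\<in>sets m. A \<subseteq> U \<and> emeasure m U \<le> packing_sup \<Psi> (1 / Suc k) E" for k :: nat
    by (rule Vitali_cover_packing_sup[OF X \<open>A \<subseteq> X\<close> _ light \<open>A \<subseteq> E\<close>]) auto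
  then obtain U where U: "\<And>k. U k \<in> sets m" "\<And>k. A \<subseteq> U k"
    "\<And>k. emeasure m (U k) \<le> packing_sup \<Psi> (1 / Suc k) E"
    by metis
  have "emeasure m (\<Inter>k. U k) \<le> packing_sup \<Psi> \<eta> E" if "\<eta> > 0" for \<eta>
  proof -
    obtain k where k: "1 / Suc k < \<eta>"
      using reals_Archimedean[OF \<open>\<eta> > 0\<close>] by (auto simp: inverse_eq_divide)
    have "emeasure m (\<Inter>k. U k) \<le> emeasure m (U k)"
      using U(1) by (intro emeasure_mono) auto
    also have "\<dots> \<le> packing_sup \<Psi> \<eta> E"
      using U(3)[of k] packing_sup_mono[of "1 / Suc k" \<eta> \<Psi> E] k by (meson less_imp_le order_trans)
    finally show ?thesis .
  qed
  then have "emeasure m (\<Inter>k. U k) \<le> packing_premeasure \<Psi> E"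
    unfolding packing_premeasure_eq_INF by (intro INF_greatest) auto
  moreover have "(\<Inter>k. U k) \<in> sets m"
    using U(1) by (intro sets.countable_INT) auto
  ultimately show ?thesis
    using U(2) by blast
qed

text \<open>The density theorem for packing measures: up to a null set, the part of each member of a countable
  cover of \<open>E\<close> within \<open>X\<close> lies in a measurable set whose mass is at most the packing premeasure of
  that member, so that \<open>m E\<close> is at most the packing measure of \<open>E\<close>.\<close>

proposition abs_cont_packing_if_balls_frequently_light:
  fixes m :: "'a::euclidean_space measure"
  assumes sets_m: "sets m = sets (restrict_space borel X)"
    and light: "AE x in m.
      \<exists>\<^sub>F r in at_right 0. emeasure m (cball x (5 * r) \<inter> X) \<le> ennreal (\<Psi> (2 * r))"
  shows "abs_cont_packing m \<Psi>"
  unfolding abs_cont_packing_def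
proof (intro ballI impI)
  fix E assume E: "E \<in> sets m" and zero: "packing_measure \<Psi> E = 0"
  define G where "G = {x \<in> X.
    \<exists>\<^sub>F r in at_right 0. emeasure m (cball x (5 * r) \<inter> X) \<le> ennreal (\<Psi> (2 * r))}"
  have space_m: "space m = X"
    using sets_eq_imp_space_eq[OF sets_m] by (simp add: space_restrict_space)
  have X: "cball x r \<inter> X \<in> sets m" for x r
    unfolding sets_m sets_restrict_space by (auto simp: Int_commute)
  obtain N where N: "N \<in> null_sets m" "X - G \<subseteq> N"
    using light unfolding eventually_ae_filter space_m G_def by blast
  have "emeasure m E \<le> \<epsilon>" if "\<epsilon> > 0" for \<epsilon>
  proof -
    obtain A :: "nat \<Rightarrow> 'a set" where A: "E \<subseteq> (\<Union>i. A i)" "(\<Sum>i. packing_premeasure \<Psi> (A i)) < \<epsilon>"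
      using zero \<open>\<epsilon> > 0\<close> unfolding packing_measure_def by (metis (mono_tags, lifting) INF_less_iff mem_Collect_eq)
    have "\<exists>U\<in>sets m. A i \<inter> G \<subseteq> U \<and> emeasure m U \<le> packing_premeasure \<Psi> (A i)" for i
      by (rule Vitali_cover_packing_premeasure[OF X]) (auto simp: G_def)
    then obtain U where U: "\<And>i. U i \<in> sets m" "\<And>i. A i \<inter> G \<subseteq> U i"
      "\<And>i. emeasure m (U i) \<le> packing_premeasure \<Psi> (A i)"
      by metis
    have "E \<subseteq> (\<Union>i. U i) \<union> N"
    proof
      fix x assume "x \<in> E"
      then have "x \<in> X"
        using sets.sets_into_space[OF E] space_m by auto
      then show "x \<in> (\<Union>i. U i) \<union> N"
        using A(1) U(2) N(2) \<open>x \<in> E\<close> by blast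
    qed
    then have "emeasure m E \<le> emeasure m ((\<Union>i. U i) \<union> N)"
      using U(1) N(1) by (intro emeasure_mono) auto
    also have "\<dots> = emeasure m (\<Union>i. U i)"
      using U(1) N(1) by (intro emeasure_Un_null_set) auto
    also have "\<dots> \<le> (\<Sum>i. emeasure m (U i))"
      using U(1) by (intro emeasure_subadditive_countably) auto
    also have "\<dots> \<le> (\<Sum>i. packing_premeasure \<Psi> (A i))"
      using U(3) by (intro suminf_le) auto
    finally show ?thesis
      using A(2) by simp
  qed
  then show "emeasure m E = 0"
    by (metis dense not_gr_zero not_le)
qed

section \<open>Geometry of adic cubes\<close>

text \<open>In this form it is visible that the cubes of one generation are the fibres of a map, hence disjoint.\<close>

lemma adic_cube_eq_floor:
  assumes "l \<ge> 1"
  shows "adic_cube l n k = {x. \<forall>i. \<lfloor>x $ i * real l ^ n\<rfloor> = int (k i)}"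
proof -
  have "0 < real l ^ n"
    using assms by simp
  then show ?thesis
    by (simp add: adic_cube_def floor_eq_iff field_simps)
qed

lemma unit_box_eq_adic_cube: "unit_box = adic_cube l 0 (\<lambda>_. 0)"
  by (simp add: unit_box_def adic_cube_def)

lemma adic_cube_borel [measurable]: "adic_cube l n k \<in> sets borel"
proof -
  have "adic_cube l n k = (\<Inter>i. {x. x $ i \<ge> real (k i) / real l ^ n} \<inter>
      {x. x $ i < (real (k i) + 1) / real l ^ n})"
    by (auto simp: adic_cube_def)
  also have "\<dots> \<in> sets borel"
    by (intro sets.countable_INT'' sets.Int borel_closed borel_open
        closed_halfspace_component_ge_cart open_halfspace_component_lt_cart) auto
  finally show ?thesis .
qed

lemma unit_box_borel [measurable]: "unit_box \<in> sets borel"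
  by (simp add: unit_box_eq_adic_cube[of 0])

lemma adic_cubes_disjoint:
  assumes "l \<ge> 1" "I \<in> adic_cubes l n" "J \<in> adic_cubes l n" "x \<in> I" "x \<in> J"
  shows "I = J"
proof -
  obtain k k' where k: "I = adic_cube l n k" "J = adic_cube l n k'"
    using assms by (auto simp: adic_cubes_def)
  have "\<lfloor>x $ i * real l ^ n\<rfloor> = int (k i)" "\<lfloor>x $ i * real l ^ n\<rfloor> = int (k' i)" for i
    using assms(4,5) unfolding k adic_cube_eq_floor[OF assms(1)] by auto
  then have "k = k'"
    by (intro ext) simp
  then show ?thesis
    using k by simp
qed

lemma adic_cubes_subset_unit_box:
  assumes "l \<ge> 1" "I \<in> adic_cubes l n"
  shows "I \<subseteq> unit_box"
proof
  fix x assume "x \<in> I"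
  obtain k where k: "I = adic_cube l n k" "\<And>i. k i < l ^ n"
    using assms by (auto simp: adic_cubes_def)
  have "0 \<le> x $ i \<and> x $ i < 1" for i
  proof
    have bounds: "real (k i) / real l ^ n \<le> x $ i" "x $ i < (real (k i) + 1) / real l ^ n"
      using \<open>x \<in> I\<close> unfolding k adic_cube_def by auto
    then show "0 \<le> x $ i"
      by (smt (verit) divide_nonneg_nonneg of_nat_0_le_iff zero_le_power)
    have "real (k i) + 1 \<le> real l ^ n"
      using k(2)[of i] by (metis Suc_leI add.commute of_nat_Suc of_nat_le_iff of_nat_power)
    then have "(real (k i) + 1) / real l ^ n \<le> 1"
      using assms(1) by simp
    then show "x $ i < 1"
      using bounds by linarith
  qed
  then show "x \<in> unit_box"
    by (simp add: unit_box_def)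
qed

lemma unit_box_covered_by_adic_cubes:
  assumes "l \<ge> 1" "x \<in> unit_box"
  obtains I where "I \<in> adic_cubes l n" "x \<in> I"
proof
  define k where "k i = nat \<lfloor>x $ i * real l ^ n\<rfloor>" for i
  have x: "0 \<le> x $ i" "x $ i < 1" for i
    using assms(2) by (auto simp: unit_box_def)
  have pos: "0 < real l ^ n"
    using assms(1) by simp
  have "k i < l ^ n" for i
  proof -
    have "x $ i * real l ^ n < real l ^ n"
      using x(2)[of i] pos by simp
    then have "\<lfloor>x $ i * real l ^ n\<rfloor> < int (l ^ n)"
      by (simp add: floor_less_iff)
    then show ?thesis
      using x(1)[of i] pos by (simp add: k_def nat_less_iff)
  qed
  then show "adic_cube l n k \<in> adic_cubes l n"
    by (auto simp: adic_cubes_def)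
  show "x \<in> adic_cube l n k"
    using x(1) pos unfolding adic_cube_eq_floor[OF assms(1)] by (simp add: k_def)
qed

lemma dist_in_adic_cube:
  fixes x y :: "real ^ 'n"
  assumes "l \<ge> 1" "I \<in> adic_cubes l n" "x \<in> I" "y \<in> I"
  shows "dist x y \<le> real CARD('n) / real l ^ n"
proof -
  obtain k where k: "I = adic_cube l n k"
    using assms by (auto simp: adic_cubes_def)
  have "\<bar>(x - y) $ i\<bar> \<le> 1 / real l ^ n" for i
  proof -
    have "real (k i) / real l ^ n \<le> x $ i" "x $ i < (real (k i) + 1) / real l ^ n"
      "real (k i) / real l ^ n \<le> y $ i" "y $ i < (real (k i) + 1) / real l ^ n"
      using assms(3,4) unfolding k adic_cube_def by auto
    then show ?thesis
      by (simp add: add_divide_distrib)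
  qed
  then have "(\<Sum>i\<in>UNIV. \<bar>(x - y) $ i\<bar>) \<le> (\<Sum>i\<in>(UNIV :: 'n set). 1 / real l ^ n)"
    by (intro sum_mono)
  then show ?thesis
    using norm_le_l1_cart[of "x - y"] by (simp add: dist_norm)
qed

text \<open>The constant is the radius of the fivefold enlargement of a ball of diameter \<open>1 / l ^ n\<close>. Thus these
  are the cubes that can meet the enlargement of such a ball with centre in \<open>I\<close>.\<close>

definition near_cubes :: "nat \<Rightarrow> nat \<Rightarrow> (real ^ 'n) set \<Rightarrow> (real ^ 'n) set set" where
  "near_cubes l n I =
     {J \<in> adic_cubes l n. \<exists>x\<in>I. \<exists>y\<in>J. dist x y \<le> 5 / (2 * real l ^ n)}"

lemma near_cubes_sym:
  assumes "I \<in> adic_cubes l n" "J \<in> near_cubes l n I"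
  shows "I \<in> near_cubes l n J"
proof -
  obtain x y where "x \<in> I" "y \<in> J" "dist y x \<le> 5 / (2 * real l ^ n)"
    using assms(2) unfolding near_cubes_def by (auto simp: dist_commute)
  then show ?thesis
    using assms(1) unfolding near_cubes_def by blast
qed

text \<open>Two points at distance at most \<open>5/2\<close> in every coordinate have integer parts that differ by at
  most 3, which leaves 7 possibilities for each coordinate.\<close>

lemma card_near_cubes_le:
  fixes I :: "(real ^ 'n) set"
  assumes "l \<ge> 1" "I \<in> adic_cubes l n"
  shows "card (near_cubes l n I) \<le> 7 ^ CARD('n)"
proof -
  obtain k where k: "I = adic_cube l n k"
    using assms by (auto simp: adic_cubes_def)
  define R where "R = (\<Pi>\<^sub>E i\<in>UNIV. {k i - 3..k i + 3})"
  have pos: "0 < real l ^ n"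
    using assms(1) by simp
  have "near_cubes l n I \<subseteq> adic_cube l n ` R"
  proof
    fix J assume "J \<in> near_cubes l n I"
    then obtain k' x y where k': "J = adic_cube l n k'" and xy: "x \<in> I" "y \<in> J"
      "dist x y \<le> 5 / (2 * real l ^ n)"
      by (auto simp: near_cubes_def adic_cubes_def)
    have "k' i \<in> {k i - 3..k i + 3}" for i
    proof -
      have floors: "\<lfloor>x $ i * real l ^ n\<rfloor> = int (k i)" "\<lfloor>y $ i * real l ^ n\<rfloor> = int (k' i)"
        using xy unfolding k k' adic_cube_eq_floor[OF assms(1)] by auto
      have "\<bar>x $ i - y $ i\<bar> \<le> 5 / (2 * real l ^ n)"
        using component_le_norm_cart[of "x - y" i] xy(3) by (simp add: dist_norm)
      then have "\<bar>x $ i - y $ i\<bar> * real l ^ n \<le> 5 / 2"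
        using pos by (simp add: field_simps)
      then have "\<bar>x $ i * real l ^ n - y $ i * real l ^ n\<bar> \<le> 5 / 2"
        using pos by (simp add: abs_mult flip: left_diff_distrib)
      then have "\<bar>int (k i) - int (k' i)\<bar> \<le> 3"
        using floors by linarith
      then show ?thesis
        by auto
    qed
    then show "J \<in> adic_cube l n ` R"
      using k' by (auto simp: R_def PiE_UNIV_domain)
  qed
  moreover have finite_R: "finite R"
    unfolding R_def by (intro finite_PiE) auto
  ultimately have "card (near_cubes l n I) \<le> card (adic_cube l n ` R :: (real ^ 'n) set set)"
    by (intro card_mono) auto
  also have "\<dots> \<le> card R"
    using finite_R by (rule card_image_le)
  also have "\<dots> = (\<Prod>i\<in>UNIV. card {k i - 3..k i + 3})"
    unfolding R_def by (subst card_PiE) auto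
  also have "\<dots> \<le> (\<Prod>i\<in>(UNIV :: 'n set). 7)"
    by (intro prod_mono) auto
  finally show ?thesis
    by simp
qed

lemma finite_adic_cubes: "finite (adic_cubes l n :: (real ^ 'n) set set)"
proof -
  have "{k :: 'n \<Rightarrow> nat. \<forall>i. k i < l ^ n} = (\<Pi>\<^sub>E i\<in>UNIV. {..<l ^ n})"
    by (auto simp: PiE_UNIV_domain)
  then show ?thesis
    unfolding adic_cubes_def by (simp add: finite_PiE)
qed

section \<open>Partition sums and the spectrum of a quasi-Bernoulli measure\<close>

locale quasi_Bernoulli_measure = prob_space m
  for m :: "(real ^ 'n) measure" +
  fixes l :: nat and c :: "nat list \<Rightarrow> (real ^ 'n) set" and C :: real
  assumes l_ge_2: "2 \<le> l"
    and coding: "adic_coding l c"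
    and sets_m: "sets m = sets (restrict_space borel unit_box)"
    and C_ge_1: "1 \<le> C"
    and quasi_lower: "\<And>u v. u \<in> adic_words CARD('n) l \<Longrightarrow> v \<in> adic_words CARD('n) l \<Longrightarrow>
      1 / C * measure m (c u) * measure m (c v) \<le> measure m (c (u @ v))"
    and quasi_upper: "\<And>u v. u \<in> adic_words CARD('n) l \<Longrightarrow> v \<in> adic_words CARD('n) l \<Longrightarrow>
      measure m (c (u @ v)) \<le> C * measure m (c u) * measure m (c v)"
begin

abbreviation \<mu> :: "nat list \<Rightarrow> real" where "\<mu> w \<equiv> measure m (c w)"

definition words :: "nat \<Rightarrow> nat list set" where
  "words n = {w \<in> adic_words CARD('n) l. length w = n}"

lemma l_ge_1: "1 \<le> l"
  using l_ge_2 by simp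

lemma l_gt_1_real: "1 < real l"
  using l_ge_2 by simp

lemma space_m: "space m = unit_box"
  using sets_eq_imp_space_eq[OF sets_m] by (simp add: space_restrict_space)

lemma words_adic: "w \<in> words n \<Longrightarrow> w \<in> adic_words CARD('n) l"
  by (simp add: words_def)

lemma finite_words: "finite (words n)"
proof -
  have "finite {w. set w \<subseteq> {..<l ^ CARD('n)} \<and> length w = n}"
    by (intro finite_lists_length_eq) auto
  then show ?thesis
    by (simp add: words_def adic_words_def)
qed

lemma bij_cubes: "bij_betw c (words n) (adic_cubes l n)"
  using coding by (simp add: adic_coding_def words_def)

lemma cube_in_adic_cubes: "w \<in> words n \<Longrightarrow> c w \<in> adic_cubes l n"
  using bij_cubes[of n] by (auto simp: bij_betw_def)

lemma append_words: "u \<in> words p \<Longrightarrow> v \<in> words n \<Longrightarrow> u @ v \<in> words (p + n)"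
  by (auto simp: words_def adic_words_def)

lemma bij_append: "bij_betw (\<lambda>(u, v). u @ v) (words p \<times> words n) (words (p + n))"
proof (rule bij_betwI[where g="\<lambda>w. (take p w, drop p w)"])
  show "(\<lambda>(u, v). u @ v) \<in> words p \<times> words n \<rightarrow> words (p + n)"
    using append_words by auto
  show "(\<lambda>w. (take p w, drop p w)) \<in> words (p + n) \<rightarrow> words p \<times> words n"
    by (auto simp: words_def adic_words_def dest!: in_set_takeD in_set_dropD)
qed (auto simp: words_def)

lemma sum_words_append:
  "(\<Sum>w\<in>words (p + n). f w) = (\<Sum>u\<in>words p. \<Sum>v\<in>words n. f (u @ v))"
proof -
  have "(\<Sum>w\<in>words (p + n). f w) = (\<Sum>x\<in>words p \<times> words n. f (case x of (u, v) \<Rightarrow> u @ v))"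
    by (rule sum.reindex_bij_betw[OF bij_append, symmetric])
  then show ?thesis
    by (simp add: sum.cartesian_product split_def)
qed

lemma cube_append_subset: "u @ v \<in> adic_words CARD('n) l \<Longrightarrow> c (u @ v) \<subseteq> c u"
proof (induction v rule: rev_induct)
  case (snoc x v)
  have "c ((u @ v) @ [x]) \<subseteq> c (u @ v)"
    using coding snoc.prems unfolding adic_coding_def append_assoc[symmetric] by blast
  moreover have "u @ v \<in> adic_words CARD('n) l"
    using snoc.prems by (simp add: adic_words_def)
  ultimately show ?case
    using snoc.IH by auto
qed simp

lemma cubes_eq:
  assumes "u \<in> words n" "v \<in> words n" "x \<in> c u" "x \<in> c v"
  shows "u = v"
proof -
  have "c u = c v"
    using cube_in_adic_cubes assms by (intro adic_cubes_disjoint[OF l_ge_1, of _ n _ x]) auto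
  then show ?thesis
    using inj_onD[OF bij_betw_imp_inj_on[OF bij_cubes]] assms(1,2) by blast
qed

lemma cube_of_point:
  assumes "x \<in> unit_box"
  obtains w where "w \<in> words n" "x \<in> c w"
proof -
  obtain I where "I \<in> adic_cubes l n" "x \<in> I"
    using unit_box_covered_by_adic_cubes[OF l_ge_1 assms] .
  then show ?thesis
    using bij_betw_imp_surj_on[OF bij_cubes, of n] that by blast
qed

lemma adic_cube_sets: "I \<in> adic_cubes l n \<Longrightarrow> I \<in> sets m"
  unfolding sets_m using adic_cubes_subset_unit_box[OF l_ge_1, of I n]
  by (auto simp: sets_restrict_space_iff adic_cubes_def)

lemma cube_sets: "w \<in> words n \<Longrightarrow> c w \<in> sets m"
  using adic_cube_sets cube_in_adic_cubes by blast

lemma cube_subset: "w \<in> words n \<Longrightarrow> c w \<subseteq> unit_box"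
  using adic_cubes_subset_unit_box[OF l_ge_1] cube_in_adic_cubes by blast

lemma UN_cubes_sets: "T \<subseteq> words n \<Longrightarrow> (\<Union>w\<in>T. c w) \<in> sets m"
  by (intro sets.finite_UN) (auto intro: finite_subset finite_words cube_sets)

lemma disjoint_cubes: "disjoint_family_on c (words n)"
  by (auto simp: disjoint_family_on_def dest: cubes_eq)

lemma measure_UN_cubes: "T \<subseteq> words n \<Longrightarrow> measure m (\<Union>w\<in>T. c w) = (\<Sum>w\<in>T. \<mu> w)"
  using finite_words[of n] disjoint_cubes[of n] cube_sets
  by (intro finite_measure_finite_Union)
    (auto intro: finite_subset disjoint_family_on_mono)

lemma sum_\<mu>: "(\<Sum>w\<in>words n. \<mu> w) = 1"
proof -
  have "unit_box \<subseteq> (\<Union>w\<in>words n. c w)"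
  proof
    fix x :: "real ^ 'n" assume "x \<in> unit_box"
    then obtain w where "w \<in> words n" "x \<in> c w"
      by (rule cube_of_point)
    then show "x \<in> (\<Union>w\<in>words n. c w)"
      by blast
  qed
  then have "(\<Union>w\<in>words n. c w) = space m"
    using cube_subset space_m by auto
  then show ?thesis
    using measure_UN_cubes[of "words n" n] prob_space by simp
qed

lemma ex_positive_word: "\<exists>w\<in>words n. 0 < \<mu> w"
proof (rule ccontr)
  assume "\<not> ?thesis"
  then have "(\<Sum>w\<in>words n. \<mu> w) \<le> 0"
    by (intro sum_nonpos) (auto simp: not_less)
  then show False
    by (simp add: sum_\<mu>)
qed

lemma cube_at_eq:
  assumes "w \<in> words n" "x \<in> c w"
  shows "cube_at l n x = c w"
  unfolding cube_at_def
proof (rule the_equality)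
  show "c w \<in> adic_cubes l n \<and> x \<in> c w"
    using assms cube_in_adic_cubes by simp
  show "I = c w" if "I \<in> adic_cubes l n \<and> x \<in> I" for I
    using adic_cubes_disjoint[OF l_ge_1, of I n "c w" x] that assms cube_in_adic_cubes by simp
qed

definition Z :: "nat \<Rightarrow> real \<Rightarrow> real" where
  "Z n s = (\<Sum>w\<in>words n. \<mu> w powr s)"

lemma Z_pos: "0 < Z n s"
proof -
  obtain w where "w \<in> words n" "0 < \<mu> w"
    using ex_positive_word by blast
  then show ?thesis
    unfolding Z_def using finite_words by (intro sum_pos2[of _ w]) auto
qed

lemma Z_1: "Z n 1 = 1"
  by (simp add: Z_def sum_\<mu>)

text \<open>For exponents between 0 and 1, \<open>C powr s \<le> C\<close>, so that one constant serves all of them.\<close>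

lemma Z_quasi_multiplicative:
  assumes s: "0 \<le> s" "s \<le> 1"
  shows "Z p s * Z n s / C \<le> Z (p + n) s" and "Z (p + n) s \<le> C * (Z p s * Z n s)"
proof -
  have product: "Z p s * Z n s = (\<Sum>u\<in>words p. \<Sum>v\<in>words n. \<mu> u powr s * \<mu> v powr s)"
    by (simp add: Z_def sum_product)
  have C_powr: "C powr s \<le> C"
    using powr_mono[of s 1 C] s C_ge_1 by simp
  have "\<mu> u powr s * \<mu> v powr s / C \<le> \<mu> (u @ v) powr s"
    if "u \<in> words p" "v \<in> words n" for u v
  proof -
    have "\<mu> u powr s * \<mu> v powr s / C \<le> \<mu> u powr s * \<mu> v powr s / C powr s"
      using C_powr C_ge_1 by (intro divide_left_mono) auto
    also have "\<dots> = (1 / C * \<mu> u * \<mu> v) powr s"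
      using C_ge_1 by (simp add: powr_mult powr_divide)
    also have "\<dots> \<le> \<mu> (u @ v) powr s"
      using quasi_lower[of u v] that words_adic s C_ge_1 by (intro powr_mono2) auto
    finally show ?thesis .
  qed
  then show "Z p s * Z n s / C \<le> Z (p + n) s"
    unfolding product unfolding Z_def sum_words_append sum_divide_distrib by (intro sum_mono)
  have "\<mu> (u @ v) powr s \<le> C * (\<mu> u powr s * \<mu> v powr s)"
    if "u \<in> words p" "v \<in> words n" for u v
  proof -
    have "\<mu> (u @ v) powr s \<le> (C * \<mu> u * \<mu> v) powr s"
      using quasi_upper[of u v] that words_adic s by (intro powr_mono2) auto
    also have "\<dots> = C powr s * (\<mu> u powr s * \<mu> v powr s)"
      using C_ge_1 by (simp add: powr_mult)
    also have "\<dots> \<le> C * (\<mu> u powr s * \<mu> v powr s)"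
      using C_powr by (intro mult_right_mono) auto
    finally show ?thesis .
  qed
  then show "Z (p + n) s \<le> C * (Z p s * Z n s)"
    unfolding product unfolding Z_def sum_words_append sum_distrib_left by (intro sum_mono)
qed

abbreviation \<tau> :: "real \<Rightarrow> real" where "\<tau> \<equiv> Lq_spectrum l m"

text \<open>Restricting the sum to cubes of positive mass makes no difference, because \<open>0 powr s = 0\<close>.\<close>

lemma Lq_spectrum_eq: "\<tau> s = real_of_ereal (limsup (\<lambda>n. ereal (log l (Z n s) / n)))"
proof -
  have "(\<Sum>I\<in>{I \<in> adic_cubes l n. measure m I > 0}. measure m I powr s) = Z n s" for n
  proof -
    have "(\<Sum>I\<in>{I \<in> adic_cubes l n. measure m I > 0}. measure m I powr s)
        = (\<Sum>I\<in>adic_cubes l n. measure m I powr s)"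
      using finite_adic_cubes
      by (intro sum.mono_neutral_left) (auto simp: zero_less_measure_iff)
    also have "\<dots> = Z n s"
      unfolding Z_def by (rule sum.reindex_bij_betw[OF bij_cubes, symmetric])
    finally show ?thesis .
  qed
  then show ?thesis
    by (simp add: Lq_spectrum_def log_def mult.commute)
qed

text \<open>The error is bounded uniformly in \<open>n\<close>. This is what quasi-Bernoulli gives beyond the existence of
  the limit, and it makes the exponential moments of \<open>S_n\<close> known up to a multiplicative constant.\<close>

lemma log_Z_bound:
  assumes s: "0 \<le> s" "s \<le> 1"
  shows "\<bar>log l (Z n s) - n * \<tau> s\<bar> \<le> log l C"
proof -
  have "\<bar>log l (Z (p + n) s) - log l (Z p s) - log l (Z n s)\<bar> \<le> log l C" for p n
  proof -
    have "log l (Z p s * Z n s / C) \<le> log l (Z (p + n) s)"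
      using Z_quasi_multiplicative(1)[OF s] Z_pos C_ge_1 l_gt_1_real
      by (subst log_le_cancel_iff) auto
    moreover have "log l (Z (p + n) s) \<le> log l (C * (Z p s * Z n s))"
      using Z_quasi_multiplicative(2)[OF s] Z_pos C_ge_1 l_gt_1_real
      by (subst log_le_cancel_iff) auto
    moreover have "0 < Z p s" "0 < Z n s" "0 < C"
      using Z_pos C_ge_1 by auto
    ultimately show ?thesis
      using l_gt_1_real by (auto simp: log_mult log_divide abs_le_iff)
  qed
  then obtain L where L: "\<And>n. \<bar>log l (Z n s) - real n * L\<bar> \<le> log l C"
    using quasi_additive_imp_linear[of "\<lambda>n. log l (Z n s)" "log l C"] by blast
  then have "(\<lambda>n. log l (Z n s) / n) \<longlonglongrightarrow> L"
    by (rule linear_up_to_const_imp_tendsto)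
  then have "limsup (\<lambda>n. ereal (log l (Z n s) / n)) = ereal L"
    by (intro lim_imp_Limsup) auto
  then show ?thesis
    using L by (simp add: Lq_spectrum_eq)
qed

lemma log_Z_limit:
  assumes s: "0 \<le> s" "s \<le> 1"
  shows "(\<lambda>n. log l (Z n s) / n) \<longlonglongrightarrow> \<tau> s"
  using log_Z_bound[OF s] by (rule linear_up_to_const_imp_tendsto)

lemma \<tau>_1: "\<tau> 1 = 0"
proof -
  have "(\<lambda>n. log l (Z n 1) / n) \<longlonglongrightarrow> \<tau> 1"
    by (rule log_Z_limit) auto
  then show ?thesis
    by (simp add: Z_1 LIMSEQ_const_iff)
qed

lemma convex_\<tau>: "convex_on {0..1} \<tau>"
proof (rule convex_onI)
  fix t x y :: real
  assume t: "0 < t" "t < 1" and xy: "x \<in> {0..1}" "y \<in> {0..1}"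
  define z where "z = (1 - t) * x + t * y"
  have z: "0 \<le> z" "z \<le> 1"
    using t xy convex_bound_le[of x 1 y "1 - t" t] by (auto simp: z_def)
  have "log l (Z n z) / n \<le> (1 - t) * (log l (Z n x) / n) + t * (log l (Z n y) / n)" for n
  proof -
    have "convex_on UNIV (\<lambda>s. ln (Z n s))"
      unfolding Z_def using ex_positive_word finite_words by (intro convex_on_ln_sum_powr) auto
    then have "ln (Z n z) \<le> (1 - t) * ln (Z n x) + t * ln (Z n y)"
      using convex_onD[of UNIV "\<lambda>s. ln (Z n s)" t x y] t by (simp add: z_def)
    then have "ln (Z n z) / (ln l * n) \<le> ((1 - t) * ln (Z n x) + t * ln (Z n y)) / (ln l * n)"
      using l_gt_1_real by (intro divide_right_mono) auto
    then show ?thesis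
      by (simp add: log_def add_divide_distrib)
  qed
  moreover have "(\<lambda>n. (1 - t) * (log l (Z n x) / n) + t * (log l (Z n y) / n))
      \<longlonglongrightarrow> (1 - t) * \<tau> x + t * \<tau> y"
    using xy by (intro tendsto_intros log_Z_limit) auto
  ultimately have "\<tau> z \<le> (1 - t) * \<tau> x + t * \<tau> y"
    using log_Z_limit[OF z] by (meson LIMSEQ_le)
  then show "\<tau> ((1 - t) *\<^sub>R x + t *\<^sub>R y) \<le> (1 - t) * \<tau> x + t * \<tau> y"
    by (simp add: z_def)
qed auto

end

section \<open>The functions \<open>\<chi>\<close> and \<open>\<theta>\<close>\<close>

locale chi_doubling = quasi_Bernoulli_measure m l c C
  for m :: "(real ^ 'n) measure" and l c C +
  fixes K :: real
  assumes chi_pos: "\<And>q. 0 < q \<Longrightarrow> q \<le> 1 \<Longrightarrow> 0 < chi l m q"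
    and chi_le_half: "\<And>q. 0 < q \<Longrightarrow> q \<le> 1 \<Longrightarrow> chi l m q \<le> K * chi l m (q / 2)"
begin

abbreviation \<chi>\<^sub>m :: "real \<Rightarrow> real" where "\<chi>\<^sub>m \<equiv> chi l m"
abbreviation d :: real where "d \<equiv> qB_dim l m"
abbreviation \<theta> :: "real \<Rightarrow> real" where "\<theta> \<equiv> theta l m"

lemma chi_0: "\<chi>\<^sub>m 0 = 0"
  by (simp add: chi_def \<tau>_1)

lemma convex_chi: "convex_on {0..1} \<chi>\<^sub>m"
proof (rule convex_onI)
  fix t x y :: real
  assume t: "0 < t" "t < 1" and xy: "x \<in> {0..1}" "y \<in> {0..1}"
  have "\<tau> ((1 - t) *\<^sub>R (1 - x) + t *\<^sub>R (1 - y)) \<le> (1 - t) * \<tau> (1 - x) + t * \<tau> (1 - y)"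
    using convex_onD[OF convex_\<tau>, of t "1 - x" "1 - y"] t xy by simp
  moreover have "(1 - t) *\<^sub>R (1 - x) + t *\<^sub>R (1 - y) = 1 - ((1 - t) * x + t * y)"
    by (simp add: algebra_simps)
  ultimately show "\<chi>\<^sub>m ((1 - t) *\<^sub>R x + t *\<^sub>R y) \<le> (1 - t) * \<chi>\<^sub>m x + t * \<chi>\<^sub>m y"
    by (simp add: chi_def algebra_simps)
qed auto

lemma chi_scale_le: "0 \<le> a \<Longrightarrow> a \<le> 1 \<Longrightarrow> 0 \<le> q \<Longrightarrow> q \<le> 1 \<Longrightarrow> \<chi>\<^sub>m (a * q) \<le> a * \<chi>\<^sub>m q"
  using convex_onD[OF convex_chi, of a 0 q] by (simp add: chi_0)

lemma chi_strict_mono: "0 \<le> p \<Longrightarrow> p < q \<Longrightarrow> q \<le> 1 \<Longrightarrow> \<chi>\<^sub>m p < \<chi>\<^sub>m q"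
proof -
  assume pq: "0 \<le> p" "p < q" "q \<le> 1"
  have "\<chi>\<^sub>m p \<le> p / q * \<chi>\<^sub>m q"
    using chi_scale_le[of "p / q" q] pq by simp
  also have "\<dots> < 1 * \<chi>\<^sub>m q"
    using pq chi_pos[of q] by (intro mult_strict_right_mono) auto
  finally show ?thesis
    by simp
qed

lemma chi_mono: "0 \<le> p \<Longrightarrow> p \<le> q \<Longrightarrow> q \<le> 1 \<Longrightarrow> \<chi>\<^sub>m p \<le> \<chi>\<^sub>m q"
  using chi_strict_mono[of p q] by (cases "p = q") auto

lemma chi_le_imp_le: "\<chi>\<^sub>m p \<le> \<chi>\<^sub>m q \<Longrightarrow> 0 \<le> q \<Longrightarrow> p \<le> 1 \<Longrightarrow> p \<le> q"
  using chi_strict_mono[of q p] by linarith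

text \<open>A convex function is continuous in the interior of its interval, so the intermediate value theorem
  applies on \<open>[a, 1/2]\<close> once some \<open>a > 0\<close> with \<open>\<chi>\<^sub>m a \<le> y\<close> is found. Stopping at \<open>1/2\<close> avoids a
  possible jump at the endpoint 1, and costs nothing because only small \<open>y\<close> matter.\<close>

lemma chi_attains:
  assumes "0 < y" "y \<le> \<chi>\<^sub>m (1 / 2)"
  obtains q where "0 < q" "q \<le> 1 / 2" "\<chi>\<^sub>m q = y"
proof -
  have pos: "0 < \<chi>\<^sub>m 1"
    by (rule chi_pos) auto
  define a where "a = min (1 / 2) (y / \<chi>\<^sub>m 1)"
  have "0 < a"
    using assms(1) pos by (simp add: a_def)
  moreover have "a \<le> 1 / 2"
    unfolding a_def by (rule min.cobounded1)
  ultimately have a: "0 < a" "a \<le> 1 / 2" .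
  have "\<chi>\<^sub>m a \<le> a * \<chi>\<^sub>m 1"
    using chi_scale_le[of a 1] a by simp
  also have "\<dots> \<le> y / \<chi>\<^sub>m 1 * \<chi>\<^sub>m 1"
    using pos by (intro mult_right_mono) (auto simp: a_def)
  finally have "\<chi>\<^sub>m a \<le> y"
    using pos by simp
  moreover have "continuous_on {a..1 / 2} \<chi>\<^sub>m"
  proof -
    have "continuous_on {0<..<1} \<chi>\<^sub>m"
      by (intro convex_on_continuous convex_on_subset[OF convex_chi]) auto
    then show ?thesis
      by (rule continuous_on_subset) (use a in auto)
  qed
  ultimately obtain q where "a \<le> q" "q \<le> 1 / 2" "\<chi>\<^sub>m q = y"
    using IVT'[of \<chi>\<^sub>m a y "1 / 2"] a assms(2) by blast
  then show ?thesis
    by (intro that) (use a in auto)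
qed

text \<open>From this argument on, \<open>1 / t\<close> is a value of \<open>\<chi>\<^sub>m\<close> on \<open>[0, 1/2]\<close>, so that \<open>\<theta> t\<close> is the inverse it is
  meant to be.\<close>

definition t\<^sub>0 :: real where "t\<^sub>0 = 1 / \<chi>\<^sub>m (1 / 2)"

lemma t\<^sub>0_pos: "0 < t\<^sub>0"
  unfolding t\<^sub>0_def using chi_pos[of "1 / 2"] by simp

lemma theta_spec:
  assumes "t\<^sub>0 \<le> t"
  shows "2 \<le> \<theta> t" and "\<chi>\<^sub>m (1 / \<theta> t) = 1 / t"
proof -
  have "0 < \<chi>\<^sub>m (1 / 2)"
    by (rule chi_pos) auto
  moreover have "0 < t"
    using assms t\<^sub>0_pos by linarith
  ultimately have "0 < 1 / t" "1 / t \<le> \<chi>\<^sub>m (1 / 2)"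
    using assms unfolding t\<^sub>0_def by (simp_all add: field_simps)
  then obtain q where q: "0 < q" "q \<le> 1 / 2" "\<chi>\<^sub>m q = 1 / t"
    by (rule chi_attains)
  have "inj_on \<chi>\<^sub>m {0..1}"
    by (rule linorder_inj_onI) (use chi_strict_mono in force)+
  then have "the_inv_into {0..1} \<chi>\<^sub>m (1 / t) = q"
    using q by (intro the_inv_into_f_eq) auto
  then have \<theta>: "\<theta> t = 1 / q"
    by (simp add: theta_def)
  show "2 \<le> \<theta> t" "\<chi>\<^sub>m (1 / \<theta> t) = 1 / t"
    unfolding \<theta> using q by (simp_all add: le_divide_eq)
qed

text \<open>The function \<open>\<theta> t / t\<close> is nonincreasing, as \<open>\<chi>\<^sub>m q / q\<close> is nondecreasing. Hence \<open>\<theta>\<close> hardly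
  changes when a bounded amount is added to a large argument.\<close>

lemma theta_add_le:
  assumes "t\<^sub>0 \<le> t" "0 \<le> p"
  shows "\<theta> (t + p) \<le> (t + p) / t * \<theta> t"
proof -
  have t: "0 < t"
    using assms t\<^sub>0_pos by simp
  have \<theta>: "2 \<le> \<theta> t" "2 \<le> \<theta> (t + p)"
    using theta_spec(1) assms by auto
  have "\<chi>\<^sub>m (t / (t + p) * (1 / \<theta> t)) \<le> t / (t + p) * (1 / t)"
    using chi_scale_le[of "t / (t + p)" "1 / \<theta> t"] t assms \<theta> theta_spec(2)[of t] by simp
  also have "\<dots> = \<chi>\<^sub>m (1 / \<theta> (t + p))"
    using theta_spec(2)[of "t + p"] t assms by simp
  finally have "t / (t + p) * (1 / \<theta> t) \<le> 1 / \<theta> (t + p)"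
  proof (rule chi_le_imp_le)
    show "t / (t + p) * (1 / \<theta> t) \<le> 1"
      using t \<theta> assms by (intro mult_le_one) auto
  qed (use \<theta> in auto)
  then have "inverse ((t + p) / t * \<theta> t) \<le> inverse (\<theta> (t + p))"
    by (simp add: inverse_eq_divide)
  then show ?thesis
    by (rule inverse_le_imp_le) (use \<theta> t assms in \<open>auto intro!: divide_pos_pos mult_pos_pos\<close>)
qed

lemma K_ge_2: "2 \<le> K"
proof -
  have "\<chi>\<^sub>m 1 \<le> K * \<chi>\<^sub>m (1 / 2)" "\<chi>\<^sub>m (1 / 2) \<le> 1 / 2 * \<chi>\<^sub>m 1" "0 < \<chi>\<^sub>m (1 / 2)"
    using chi_le_half[of 1] chi_scale_le[of "1 / 2" 1] chi_pos[of "1 / 2"] by auto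
  then have "2 * \<chi>\<^sub>m (1 / 2) \<le> K * \<chi>\<^sub>m (1 / 2)"
    by linarith
  then show ?thesis
    using \<open>0 < \<chi>\<^sub>m (1 / 2)\<close> by simp
qed

lemma chi_double_le:
  assumes "0 < q" "2 ^ j * q \<le> 1"
  shows "\<chi>\<^sub>m (2 ^ j * q) \<le> K ^ j * \<chi>\<^sub>m q"
  using assms(2)
proof (induction j)
  case (Suc j)
  have le: "2 ^ j * q \<le> 1"
    using Suc.prems assms(1) by simp
  have "\<chi>\<^sub>m (2 ^ Suc j * q) \<le> K * \<chi>\<^sub>m (2 ^ j * q)"
    using chi_le_half[of "2 ^ Suc j * q"] Suc.prems assms(1) by simp
  also have "\<dots> \<le> K * (K ^ j * \<chi>\<^sub>m q)"
    using Suc.IH[OF le] K_ge_2 by (intro mult_left_mono) auto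
  finally show ?case
    by (simp add: mult.assoc)
qed simp

text \<open>The doubling hypothesis, iterated from 1 down to the scale of \<open>q\<close>, prevents \<open>\<chi>\<^sub>m\<close> from decaying
  faster than a power at 0.\<close>

lemma chi_ge_powr:
  assumes q: "0 < q" "q \<le> 1"
  shows "\<chi>\<^sub>m 1 / K * q powr log 2 K \<le> \<chi>\<^sub>m q"
proof -
  \<comment> \<open>the number of doublings that bring \<open>q\<close> into \<open>[1/2, 1]\<close>\<close>
  define j where "j = nat \<lfloor>log 2 (1 / q)\<rfloor>"
  have nonneg: "0 \<le> log 2 (1 / q)"
    using q by simp
  have j: "real j \<le> log 2 (1 / q)" "log 2 (1 / q) \<le> real (Suc j)"
    using nonneg unfolding j_def by linarith+
  have "2 powr real j \<le> 2 powr (log 2 (1 / q))"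
    using j by (intro powr_mono) auto
  then have le: "2 ^ j * q \<le> 1"
    using q by (simp add: powr_realpow field_simps)
  have "2 powr (log 2 (1 / q)) \<le> 2 powr real (Suc j)"
    using j by (intro powr_mono) auto
  then have ge: "1 / 2 \<le> 2 ^ j * q"
    using q by (simp add: powr_realpow field_simps del: of_nat_Suc)
  have "\<chi>\<^sub>m 1 \<le> K * \<chi>\<^sub>m (1 / 2)"
    using chi_le_half[of 1] by simp
  also have "\<dots> \<le> K * \<chi>\<^sub>m (2 ^ j * q)"
    using ge le K_ge_2 by (intro mult_left_mono chi_mono) auto
  also have "\<dots> \<le> K * (K ^ j * \<chi>\<^sub>m q)"
    using chi_double_le[OF q(1) le] K_ge_2 by (intro mult_left_mono) auto
  also have "\<dots> \<le> K * ((1 / q) powr log 2 K * \<chi>\<^sub>m q)"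
  proof -
    have "K ^ j = K powr real j"
      using K_ge_2 by (simp add: powr_realpow)
    also have "\<dots> \<le> K powr log 2 (1 / q)"
      using j K_ge_2 by (intro powr_mono) auto
    also have "\<dots> = (1 / q) powr log 2 K"
      using q K_ge_2 by (simp add: powr_def log_def mult.commute)
    finally show ?thesis
      using K_ge_2 chi_pos[OF q] by (intro mult_left_mono mult_right_mono) auto
  qed
  finally show ?thesis
    using q K_ge_2 by (simp add: powr_divide field_simps)
qed

lemma eventually_t\<^sub>0: "\<forall>\<^sub>F n in sequentially. t\<^sub>0 \<le> real n"
  using filterlim_real_sequentially by (simp add: filterlim_at_top)

lemma theta_at_top: "filterlim (\<lambda>n. \<theta> (real n)) at_top sequentially"
proof (rule filterlim_at_top_ge[where c = 1, THEN iffD2], intro allI impI)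
  fix M :: real assume M: "1 \<le> M"
  have "\<forall>\<^sub>F n in sequentially. 1 / \<chi>\<^sub>m (1 / M) \<le> real n"
    using filterlim_real_sequentially by (simp add: filterlim_at_top)
  then show "\<forall>\<^sub>F n in sequentially. M \<le> \<theta> (real n)"
    using eventually_t\<^sub>0
  proof eventually_elim
    case (elim n)
    have pos: "0 < \<chi>\<^sub>m (1 / M)" "0 < real n" "2 \<le> \<theta> (real n)"
      using M chi_pos[of "1 / M"] elim(2) t\<^sub>0_pos theta_spec(1)[OF elim(2)] by auto
    then have "1 / real n \<le> \<chi>\<^sub>m (1 / M)"
      using elim(1) by (simp add: field_simps)
    then have "\<chi>\<^sub>m (1 / \<theta> (real n)) \<le> \<chi>\<^sub>m (1 / M)"
      by (simp add: theta_spec(2)[OF elim(2)])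
    then have "1 / \<theta> (real n) \<le> 1 / M"
      using pos M by (auto intro: chi_le_imp_le)
    then show ?case
      using pos M by (simp add: field_simps)
  qed
qed

text \<open>As \<open>\<chi>\<^sub>m\<close> is bounded below by a power, so is \<open>\<theta>\<close>; in particular \<open>\<theta>\<close> absorbs logarithms. This
  leaves room for the polynomial factor that is lost in passing from cubes to balls.\<close>

lemma log_le_theta:
  assumes "0 < \<epsilon>"
  shows "\<forall>\<^sub>F n in sequentially. 2 * log l (real n) \<le> \<epsilon> * \<theta> (real n)"
proof -
  define s where "s = log 2 K"
  define b where "b = \<chi>\<^sub>m 1 / K"
  have b: "0 < b"
    using K_ge_2 chi_pos[of 1] by (auto simp: b_def)
  have ln_bound: "ln t \<le> s * ln (\<theta> t) - ln b" if "t\<^sub>0 \<le> t" for t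
  proof -
    have t: "0 < t" and \<theta>: "2 \<le> \<theta> t"
      using that t\<^sub>0_pos theta_spec(1) by auto
    have "b * (1 / \<theta> t) powr s \<le> 1 / t"
      using chi_ge_powr[of "1 / \<theta> t"] theta_spec(2)[OF that] \<theta> by (simp add: b_def s_def)
    then have "b * t \<le> \<theta> t powr s"
      using t \<theta> by (simp add: powr_divide field_simps)
    then have "ln (b * t) \<le> ln (\<theta> t powr s)"
      using b t \<theta> by (subst ln_le_cancel_iff) auto
    then show ?thesis
      using b t \<theta> by (simp add: ln_mult ln_powr)
  qed
  have "((\<lambda>y::real. 2 * (s * (ln y / y) - ln b * inverse y)) \<longlongrightarrow> 2 * (s * 0 - ln b * 0)) at_top"
    by (intro tendsto_intros ln_x_over_x_tendsto_0 tendsto_inverse_0_at_top filterlim_ident)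
  moreover have "0 < \<epsilon> * ln (real l)"
    using assms l_gt_1_real by simp
  ultimately have "\<forall>\<^sub>F y in at_top. 2 * (s * (ln y / y) - ln b * inverse y) < \<epsilon> * ln (real l)"
    by (intro order_tendstoD(2)) auto
  then have "\<forall>\<^sub>F n in sequentially. 2 * (s * (ln (\<theta> (real n)) / \<theta> (real n)) - ln b * inverse (\<theta> (real n)))
      < \<epsilon> * ln (real l)"
    using theta_at_top by (rule eventually_compose_filterlim)
  then show ?thesis
    using eventually_t\<^sub>0
  proof eventually_elim
    case (elim n)
    have \<theta>: "2 \<le> \<theta> (real n)"
      by (rule theta_spec(1)[OF elim(2)])
    have "2 * (s * ln (\<theta> (real n)) - ln b) / \<theta> (real n) < \<epsilon> * ln (real l)"
      using elim(1) by (simp add: inverse_eq_divide diff_divide_distrib)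
    then have "2 * (s * ln (\<theta> (real n)) - ln b) \<le> \<epsilon> * ln (real l) * \<theta> (real n)"
      using \<theta> by (simp add: pos_divide_less_eq)
    moreover have "2 * ln (real n) \<le> 2 * (s * ln (\<theta> (real n)) - ln b)"
      using ln_bound[OF elim(2)] by simp
    ultimately have "2 * ln (real n) \<le> \<epsilon> * ln (real l) * \<theta> (real n)"
      by (rule order_trans[rotated])
    then show ?case
      using l_gt_1_real by (simp add: log_def pos_divide_le_eq mult_ac)
  qed
qed

section \<open>Exponential moments\<close>

text \<open>The value of \<open>S_n - n d\<close> on the cube coded by \<open>w\<close>.\<close>

definition excess :: "nat \<Rightarrow> nat list \<Rightarrow> real" where
  "excess n w = - log l (\<mu> w) - real n * d"

text \<open>Tilting by \<open>l powr (q S_n)\<close> turns the weight \<open>\<mu> w\<close> into \<open>\<mu> w powr (1 - q)\<close>, so the moment is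
  \<open>Z n (1 - q)\<close> times the deterministic factor \<open>l powr (- q n d)\<close>.\<close>

lemma moment_bounds:
  assumes q: "0 \<le> q" "q \<le> 1"
  shows "l powr (n * \<chi>\<^sub>m q) / C \<le> (\<Sum>w\<in>words n. \<mu> w * l powr (q * excess n w))"
    and "(\<Sum>w\<in>words n. \<mu> w * l powr (q * excess n w)) \<le> C * l powr (n * \<chi>\<^sub>m q)"
proof -
  have "\<mu> w * l powr (q * excess n w) = \<mu> w powr (1 - q) * l powr (- (q * n * d))" for w
  proof (cases "\<mu> w = 0")
    case False
    then have pos: "0 < \<mu> w"
      by (simp add: zero_less_measure_iff)
    have "l powr (q * excess n w) = (l powr log l (\<mu> w)) powr (- q) * l powr (- (q * n * d))"
      unfolding powr_powr powr_add[symmetric]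
      by (rule arg_cong[where f="(powr) (real l)"]) (simp add: excess_def algebra_simps)
    also have "l powr log l (\<mu> w) = \<mu> w"
      using pos l_gt_1_real by simp
    finally show ?thesis
      using pos by (simp add: powr_diff powr_minus field_simps)
  qed simp
  then have moment: "(\<Sum>w\<in>words n. \<mu> w * l powr (q * excess n w)) = Z n (1 - q) * l powr (- (q * n * d))"
    by (simp add: Z_def sum_distrib_right)
  have "Z n (1 - q) * l powr (- (q * n * d)) = l powr (log l (Z n (1 - q)) - q * n * d)"
    using Z_pos[of n "1 - q"] l_gt_1_real by (simp add: powr_diff powr_minus field_simps)
  moreover have "\<bar>log l (Z n (1 - q)) - n * \<tau> (1 - q)\<bar> \<le> log l C"
    using q by (intro log_Z_bound) auto
  moreover have "n * \<chi>\<^sub>m q = n * \<tau> (1 - q) - q * n * d"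
    by (simp add: chi_def algebra_simps)
  ultimately have "l powr (n * \<chi>\<^sub>m q - log l C) \<le> (\<Sum>w\<in>words n. \<mu> w * l powr (q * excess n w))"
    "(\<Sum>w\<in>words n. \<mu> w * l powr (q * excess n w)) \<le> l powr (log l C + n * \<chi>\<^sub>m q)"
    unfolding moment using l_gt_1_real by (auto intro!: powr_mono)
  then show "l powr (n * \<chi>\<^sub>m q) / C \<le> (\<Sum>w\<in>words n. \<mu> w * l powr (q * excess n w))"
    "(\<Sum>w\<in>words n. \<mu> w * l powr (q * excess n w)) \<le> C * l powr (n * \<chi>\<^sub>m q)"
    using C_ge_1 l_gt_1_real by (auto simp: powr_diff powr_add)
qed

end

section \<open>Sets of full measure and masses of balls\<close>

context quasi_Bernoulli_measure
begin

text \<open>An open set is, within the unit box, the increasing union over \<open>n\<close> of the cubes of generation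
  \<open>n\<close> contained in it. For each \<open>n\<close> this union is disjoint.\<close>

lemma dense_in_open_if_dense_in_cubes:
  assumes B: "B \<in> sets m"
    and dense: "\<And>n u. u \<in> words n \<Longrightarrow> \<delta> * \<mu> u \<le> measure m (c u \<inter> B)"
    and V: "open V"
  shows "\<delta> * measure m (V \<inter> unit_box) \<le> measure m (V \<inter> B)"
proof -
  define T where "T n = {w \<in> words n. c w \<subseteq> V}" for n
  define U where "U n = (\<Union>w\<in>T n. c w)" for n
  have T: "T n \<subseteq> words n" for n
    by (auto simp: T_def)
  have U_sets: "U n \<in> sets m" for n
    unfolding U_def by (rule UN_cubes_sets[OF T])
  have dense_U: "\<delta> * measure m (U n) \<le> measure m (U n \<inter> B)" for n
  proof -
    have "\<delta> * measure m (U n) = (\<Sum>w\<in>T n. \<delta> * \<mu> w)"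
      unfolding U_def by (simp add: measure_UN_cubes[OF T] sum_distrib_left)
    also have "\<dots> \<le> (\<Sum>w\<in>T n. measure m (c w \<inter> B))"
      using dense T by (intro sum_mono) auto
    also have "\<dots> = measure m (\<Union>w\<in>T n. c w \<inter> B)"
    proof (rule finite_measure_finite_Union[symmetric])
      show "finite (T n)"
        using T finite_words by (rule finite_subset)
      show "(\<lambda>w. c w \<inter> B) ` T n \<subseteq> sets m"
        using B by (auto simp: T_def intro: cube_sets[of _ n])
      show "disjoint_family_on (\<lambda>w. c w \<inter> B) (T n)"
        using disjoint_cubes[of n] T unfolding disjoint_family_on_def by blast
    qed
    also have "(\<Union>w\<in>T n. c w \<inter> B) = U n \<inter> B"
      by (auto simp: U_def)
    finally show ?thesis .
  qed
  have "incseq U"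
  proof (rule incseq_SucI, rule subsetI)
    fix n x assume "x \<in> U n"
    then obtain w where w: "w \<in> words n" "c w \<subseteq> V" "x \<in> c w"
      by (auto simp: U_def T_def)
    then have "x \<in> unit_box"
      using cube_subset by blast
    then obtain w' where w': "w' \<in> words (Suc n)" "x \<in> c w'"
      by (rule cube_of_point)
    have "take n w' @ drop n w' \<in> adic_words CARD('n) l"
      using w' words_adic by simp
    then have "c w' \<subseteq> c (take n w')"
      using cube_append_subset[of "take n w'" "drop n w'"] by simp
    moreover have "take n w' \<in> words n"
      using w' by (auto simp: words_def adic_words_def dest: in_set_takeD)
    ultimately have "take n w' = w"
      using cubes_eq[of "take n w'" n w x] w w' by blast
    then have "c w' \<subseteq> V"
      using \<open>c w' \<subseteq> c (take n w')\<close> w by simp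
    then show "x \<in> U (Suc n)"
      using w' by (auto simp: U_def T_def)
  qed
  have UN_U: "(\<Union>n. U n) = V \<inter> unit_box"
  proof
    show "(\<Union>n. U n) \<subseteq> V \<inter> unit_box"
      using cube_subset by (fastforce simp: U_def T_def)
    show "V \<inter> unit_box \<subseteq> (\<Union>n. U n)"
    proof
      fix x assume x: "x \<in> V \<inter> unit_box"
      then obtain e where e: "0 < e" "ball x e \<subseteq> V"
        using V openE by blast
      obtain n where "real CARD('n) / e < real l ^ n"
        using real_arch_pow[OF l_gt_1_real] by blast
      then have small: "real CARD('n) / real l ^ n < e"
        using e l_gt_1_real by (simp add: field_simps)
      have "x \<in> unit_box"
        using x by simp
      then obtain w where w: "w \<in> words n" "x \<in> c w"
        by (rule cube_of_point)
      have "c w \<subseteq> ball x e"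
        using dist_in_adic_cube[OF l_ge_1 cube_in_adic_cubes[OF w(1)] w(2)] small
        by (meson le_less_trans mem_ball subsetI)
      then show "x \<in> (\<Union>n. U n)"
        using w e by (auto simp: U_def T_def)
    qed
  qed
  have "(\<lambda>n. measure m (U n)) \<longlonglongrightarrow> measure m (V \<inter> unit_box)"
    unfolding UN_U[symmetric] using U_sets \<open>incseq U\<close> by (intro finite_Lim_measure_incseq) auto
  moreover have "(\<lambda>n. measure m (U n \<inter> B)) \<longlonglongrightarrow> measure m (\<Union>n. U n \<inter> B)"
    using U_sets B \<open>incseq U\<close> by (intro finite_Lim_measure_incseq) (auto simp: incseq_def)
  moreover have "(\<Union>n. U n \<inter> B) = V \<inter> B"
    using UN_U sets.sets_into_space[OF B] space_m by auto
  ultimately show ?thesis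
    using dense_U by (auto intro!: LIMSEQ_le[OF tendsto_mult_left])
qed

text \<open>A zero-one law. If \<open>B\<close> occupies a fixed proportion of every cube, it does so in every open set.
  An open set that approximates the complement of \<open>B\<close> from outside then shows that the complement
  is null. It takes the place of the ergodicity of the shift.\<close>

lemma AE_if_dense_in_cubes:
  assumes B: "B \<in> sets m" and "0 < \<delta>"
    and dense: "\<And>n u. u \<in> words n \<Longrightarrow> \<delta> * \<mu> u \<le> measure m (c u \<inter> B)"
  shows "AE x in m. x \<in> B"
proof -
  define N where "N = unit_box - B"
  have N: "N \<in> sets m"
    using B sets.top[of m] unfolding N_def space_m by blast
  have measurable_id: "(\<lambda>x. x) \<in> measurable m borel"
    unfolding measurable_cong_sets[OF sets_m refl] by (intro measurable_restrict_space1) auto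
  define m' where "m' = distr m borel (\<lambda>x. x)"
  have m': "emeasure m' A = ennreal (measure m (A \<inter> unit_box))" if "A \<in> sets borel" for A
    using that measurable_id by (simp add: m'_def emeasure_distr space_m emeasure_eq_measure)
  have N_borel: "N \<in> sets borel"
    using N unfolding sets_m by (auto simp: sets_restrict_space_iff)
  have small: "\<delta> * measure m N \<le> 0 + \<epsilon>" if "0 < \<epsilon>" for \<epsilon>
  proof -
    have "emeasure m' N = (INF V\<in>{V. N \<subseteq> V \<and> open V}. emeasure m' V)"
    proof (rule outer_regular)
      show "emeasure m' (space m') \<noteq> \<infinity>"
        using m'[of UNIV] by (simp add: m'_def)
    qed (simp_all add: m'_def N_borel)
    moreover have "emeasure m' N < ennreal (measure m N + \<epsilon>)"
      using m'[OF N_borel] that by (simp add: N_def Int_absorb2 Diff_subset ennreal_less_iff)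
    ultimately obtain V where V: "N \<subseteq> V" "open V" "emeasure m' V < ennreal (measure m N + \<epsilon>)"
      by (auto simp: INF_less_iff)
    have V_lt: "measure m (V \<inter> unit_box) < measure m N + \<epsilon>"
      using V(3) m'[of V] V(2) by (simp add: ennreal_less_iff)
    have V_sets: "V \<inter> unit_box \<in> sets m"
      unfolding sets_m using V(2) by (auto simp: sets_restrict_space_iff)
    have "\<delta> * measure m N \<le> \<delta> * measure m (V \<inter> unit_box)"
      using \<open>0 < \<delta>\<close> V(1) V_sets
      by (intro mult_left_mono finite_measure_mono) (auto simp: N_def)
    also have "\<dots> \<le> measure m (V \<inter> B)"
      using dense_in_open_if_dense_in_cubes[OF B dense V(2)] .
    also have "V \<inter> B = (V \<inter> unit_box) - N"
      using sets.sets_into_space[OF B] by (auto simp: N_def space_m)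
    also have "measure m \<dots> = measure m (V \<inter> unit_box) - measure m N"
      using V(1) V_sets N by (intro finite_measure_Diff) (auto simp: N_def)
    finally show ?thesis
      using V_lt by simp
  qed
  then have "\<delta> * measure m N \<le> 0"
    by (rule field_le_epsilon)
  then have "measure m N = 0"
    using \<open>0 < \<delta>\<close> by (simp add: mult_le_0_iff measure_le_0_iff)
  then have "N \<in> null_sets m"
    using N by (simp add: null_sets_def emeasure_eq_measure)
  then show ?thesis
    by (rule AE_I'[OF _ subset_eq[THEN iffD2]]) (auto simp: N_def space_m)
qed

lemma sum_near_cubes_le:
  "(\<Sum>I\<in>adic_cubes l n. \<Sum>J\<in>near_cubes l n I. measure m J) \<le> 7 ^ CARD('n)"
proof -
  let ?A = "adic_cubes l n :: (real ^ 'n) set set"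
  have near: "near_cubes l n I = {J \<in> ?A. J \<in> near_cubes l n I}" for I :: "(real ^ 'n) set"
    by (auto simp: near_cubes_def)
  have "(\<Sum>I\<in>?A. \<Sum>J\<in>near_cubes l n I. measure m J)
      = (\<Sum>I\<in>?A. \<Sum>J\<in>{J \<in> ?A. J \<in> near_cubes l n I}. measure m J)"
    using near by simp
  also have "\<dots> = (\<Sum>J\<in>?A. \<Sum>I\<in>{I \<in> ?A. J \<in> near_cubes l n I}. measure m J)"
    by (rule sum.swap_restrict) (rule finite_adic_cubes)+
  also have "\<dots> \<le> (\<Sum>J\<in>?A. 7 ^ CARD('n) * measure m J)"
  proof (rule sum_mono)
    fix J assume J: "J \<in> ?A"
    have "finite (near_cubes l n J)"
      using finite_adic_cubes by (rule rev_finite_subset) (auto simp: near_cubes_def)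
    then have "card {I \<in> ?A. J \<in> near_cubes l n I} \<le> card (near_cubes l n J)"
      by (rule card_mono) (auto intro: near_cubes_sym)
    also have "\<dots> \<le> 7 ^ CARD('n)"
      by (rule card_near_cubes_le[OF l_ge_1 J])
    finally have "real (card {I \<in> ?A. J \<in> near_cubes l n I}) \<le> real (7 ^ CARD('n))"
      by (simp only: of_nat_le_iff)
    then have "real (card {I \<in> ?A. J \<in> near_cubes l n I}) * measure m J \<le> 7 ^ CARD('n) * measure m J"
      by (intro mult_right_mono) auto
    then show "(\<Sum>I\<in>{I \<in> ?A. J \<in> near_cubes l n I}. measure m J) \<le> 7 ^ CARD('n) * measure m J"
      by simp
  qed
  also have "\<dots> = 7 ^ CARD('n) * (\<Sum>w\<in>words n. \<mu> w)"
    by (simp add: sum.reindex_bij_betw[OF bij_cubes] flip: sum_distrib_left)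
  finally show ?thesis
    by (simp add: sum_\<mu>)
qed

lemma measure_ball_le_near_cubes:
  assumes "w \<in> words n" "x \<in> c w"
  shows "measure m (cball x (5 / (2 * real l ^ n)) \<inter> unit_box)
    \<le> (\<Sum>J\<in>near_cubes l n (c w). measure m J)"
proof -
  have fin: "finite (near_cubes l n (c w))"
    using finite_adic_cubes by (rule rev_finite_subset) (auto simp: near_cubes_def)
  have sets: "near_cubes l n (c w) \<subseteq> sets m"
    using adic_cube_sets by (auto simp: near_cubes_def)
  have "cball x (5 / (2 * real l ^ n)) \<inter> unit_box \<subseteq> (\<Union>J\<in>near_cubes l n (c w). J)"
  proof
    fix y assume y: "y \<in> cball x (5 / (2 * real l ^ n)) \<inter> unit_box"
    then have "y \<in> unit_box" "dist x y \<le> 5 / (2 * real l ^ n)"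
      by auto
    moreover obtain J where "J \<in> adic_cubes l n" "y \<in> J"
      using unit_box_covered_by_adic_cubes[OF l_ge_1 \<open>y \<in> unit_box\<close>] .
    ultimately show "y \<in> (\<Union>J\<in>near_cubes l n (c w). J)"
      using assms(2) unfolding near_cubes_def by blast
  qed
  then have "measure m (cball x (5 / (2 * real l ^ n)) \<inter> unit_box)
      \<le> measure m (\<Union>J\<in>near_cubes l n (c w). J)"
    using fin sets by (intro finite_measure_mono) auto
  also have "\<dots> \<le> (\<Sum>J\<in>near_cubes l n (c w). measure m J)"
    using fin sets by (intro finite_measure_subadditive_finite) auto
  finally show ?thesis .
qed

text \<open>A typical point does not lie in a cube that is much lighter than its surroundings: as every cube
  has boundedly many neighbours, the cubes whose neighbourhood is more than \<open>n\<^sup>2\<close> times heavier have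
  total mass \<open>O(1 / n\<^sup>2)\<close>, and the Borel--Cantelli lemma applies.\<close>

lemma AE_eventually_ball_le_cube:
  "AE x in m. \<forall>\<^sub>F n in sequentially.
     measure m (cball x (5 / (2 * real l ^ n)) \<inter> unit_box) \<le> (real n)\<^sup>2 * measure m (cube_at l n x)"
proof -
  define near where "near n w = (\<Sum>J\<in>near_cubes l n (c w). measure m J)" for n w
  define T where "T n = {w \<in> words n. (real n)\<^sup>2 * \<mu> w < near n w}" for n
  define bad where "bad n = (\<Union>w\<in>T n. c w)" for n
  have T: "T n \<subseteq> words n" for n
    by (auto simp: T_def)
  have near_nonneg: "0 \<le> near n w" for n w
    by (simp add: near_def sum_nonneg)
  have bad_le: "measure m (bad n) \<le> 7 ^ CARD('n) * inverse ((real n)\<^sup>2)" if "1 \<le> n" for n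
  proof -
    have "(real n)\<^sup>2 * measure m (bad n) = (\<Sum>w\<in>T n. (real n)\<^sup>2 * \<mu> w)"
      unfolding bad_def by (simp add: measure_UN_cubes[OF T] sum_distrib_left)
    also have "\<dots> \<le> (\<Sum>w\<in>T n. near n w)"
      by (intro sum_mono) (simp add: T_def)
    also have "\<dots> \<le> (\<Sum>w\<in>words n. near n w)"
      using T near_nonneg by (intro sum_mono2 finite_words) auto
    also have "\<dots> = (\<Sum>I\<in>adic_cubes l n. \<Sum>J\<in>near_cubes l n I. measure m J)"
      unfolding near_def by (rule sum.reindex_bij_betw[OF bij_cubes])
    also have "\<dots> \<le> 7 ^ CARD('n)"
      by (rule sum_near_cubes_le)
    finally show ?thesis
      using that by (simp add: field_simps)
  qed
  have "AE x in m. \<forall>\<^sub>F n in sequentially. x \<in> space m - bad n"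
  proof (rule borel_cantelli_AE1)
    show "bad n \<in> sets m" for n
      unfolding bad_def by (rule UN_cubes_sets[OF T])
    have "summable (\<lambda>n. 7 ^ CARD('n) * inverse ((real n)\<^sup>2))"
      by (intro summable_mult inverse_power_summable) auto
    then show "summable (\<lambda>n. measure m (bad n))"
      by (rule summable_comparison_test'[where N = 1]) (use bad_le in simp)
  qed (simp add: emeasure_eq_measure)
  then show ?thesis
  proof (rule AE_mp, intro AE_I2 impI)
    fix x assume x: "x \<in> space m" and "\<forall>\<^sub>F n in sequentially. x \<in> space m - bad n"
    then show "\<forall>\<^sub>F n in sequentially.
        measure m (cball x (5 / (2 * real l ^ n)) \<inter> unit_box) \<le> (real n)\<^sup>2 * measure m (cube_at l n x)"
    proof (elim eventually_mono)
      fix n assume n: "x \<in> space m - bad n"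
      have "x \<in> unit_box"
        using x space_m by simp
      then obtain w where w: "w \<in> words n" "x \<in> c w"
        by (rule cube_of_point)
      then have "near n w \<le> (real n)\<^sup>2 * \<mu> w"
        using n by (auto simp: bad_def T_def not_less)
      then show "measure m (cball x (5 / (2 * real l ^ n)) \<inter> unit_box)
          \<le> (real n)\<^sup>2 * measure m (cube_at l n x)"
        using measure_ball_le_near_cubes[OF w] unfolding near_def cube_at_eq[OF w] by linarith
    qed
  qed
qed

end

section \<open>Large deviations at the scale \<open>\<theta>\<close> and absolute continuity\<close>

context chi_doubling
begin

text \<open>The Paley--Zygmund bound for \<open>l powr (q * excess n w)\<close> with \<open>q = 2 ^ j / \<theta> n\<close>. As
  \<open>n \<chi>\<^sub>m (1 / \<theta> n) = 1\<close>, convexity gives \<open>n \<chi>\<^sub>m q \<ge> 2 ^ j\<close>, while doubling keeps \<open>n \<chi>\<^sub>m (2 q)\<close> bounded.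
  So the first moment is at least \<open>l powr (2 ^ j) / C\<close> and the second moment is bounded, both
  uniformly in \<open>n\<close>. The loss \<open>log l (2 C)\<close> in the exponent becomes negligible for large \<open>j\<close>.\<close>

lemma heavy_words:
  "\<exists>\<delta>>0. \<forall>\<^sub>F n in sequentially.
     \<delta> \<le> (\<Sum>w | w \<in> words n \<and> (1 - log l (2 * C) / 2 ^ j) * \<theta> n \<le> excess n w. \<mu> w)"
proof -
  define a where "a = l powr (2 ^ j) / (2 * C)"
  define b where "b = C * l powr (K ^ Suc j)"
  have a: "0 < a" and b: "0 < b"
    using C_ge_1 l_gt_1_real by (auto simp: a_def b_def)
  have "\<forall>\<^sub>F n in sequentially. 2 ^ Suc j \<le> \<theta> (real n)"
    using theta_at_top unfolding filterlim_at_top by blast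
  then have "\<forall>\<^sub>F n in sequentially. a\<^sup>2 / b
      \<le> (\<Sum>w | w \<in> words n \<and> (1 - log l (2 * C) / 2 ^ j) * \<theta> n \<le> excess n w. \<mu> w)"
    using eventually_t\<^sub>0
  proof eventually_elim
    case (elim n)
    have n: "0 < real n"
      using elim(2) t\<^sub>0_pos by linarith
    have \<theta>: "2 \<le> \<theta> n" "\<chi>\<^sub>m (1 / \<theta> n) = 1 / n"
      using theta_spec[OF elim(2)] by auto
    define q where "q = 2 ^ j * (1 / \<theta> n)"
    have q: "0 < q" "2 * q \<le> 1"
      using elim(1) \<theta> by (auto simp: q_def)
    have "\<chi>\<^sub>m (1 / 2 ^ j * q) \<le> 1 / 2 ^ j * \<chi>\<^sub>m q"
      using q by (intro chi_scale_le) auto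
    then have "2 ^ j \<le> n * \<chi>\<^sub>m q"
      using n \<theta>(2) by (simp add: q_def field_simps)
    then have "l powr (2 ^ j) \<le> l powr (n * \<chi>\<^sub>m q)"
      using l_gt_1_real by simp
    then have "2 * a \<le> l powr (n * \<chi>\<^sub>m q) / C"
      using C_ge_1 by (simp add: a_def divide_right_mono)
    then have first: "2 * a \<le> (\<Sum>w\<in>words n. \<mu> w * l powr (q * excess n w))"
      using moment_bounds(1)[of q n] q by linarith
    have "\<chi>\<^sub>m (2 * q) \<le> K ^ Suc j * \<chi>\<^sub>m (1 / \<theta> n)"
      using chi_double_le[of "1 / \<theta> n" "Suc j"] q \<theta>(1) by (simp add: q_def)
    then have "n * \<chi>\<^sub>m (2 * q) \<le> K ^ Suc j"
      using n \<theta>(2) by (simp add: field_simps)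
    then have "C * l powr (n * \<chi>\<^sub>m (2 * q)) \<le> b"
      unfolding b_def using C_ge_1 l_gt_1_real by (intro mult_left_mono) auto
    then have "(\<Sum>w\<in>words n. \<mu> w * l powr (2 * q * excess n w)) \<le> b"
      using moment_bounds(2)[of "2 * q" n] q by linarith
    moreover have "(l powr (q * excess n w))\<^sup>2 = l powr (2 * q * excess n w)" for w
      by (simp add: power2_eq_square mult.assoc flip: powr_add)
    ultimately have second: "(\<Sum>w\<in>words n. \<mu> w * (l powr (q * excess n w))\<^sup>2) \<le> b"
      by simp
    have "a\<^sup>2 / b \<le> (\<Sum>w | w \<in> words n \<and> a \<le> l powr (q * excess n w). \<mu> w)"
      using a b first second by (intro Paley_Zygmund_sum finite_words) (auto simp: sum_\<mu>)
    also have "\<dots> \<le> (\<Sum>w | w \<in> words n \<and> (1 - log l (2 * C) / 2 ^ j) * \<theta> n \<le> excess n w. \<mu> w)"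
    proof (rule sum_mono2)
      show "finite {w \<in> words n. (1 - log l (2 * C) / 2 ^ j) * \<theta> n \<le> excess n w}"
        using finite_words by simp
      show "{w \<in> words n. a \<le> l powr (q * excess n w)}
          \<subseteq> {w \<in> words n. (1 - log l (2 * C) / 2 ^ j) * \<theta> n \<le> excess n w}"
      proof
        fix w assume w: "w \<in> {w \<in> words n. a \<le> l powr (q * excess n w)}"
        then have "log l a \<le> log l (l powr (q * excess n w))"
          using a l_gt_1_real by (subst log_le_cancel_iff) auto
        then have "log l a \<le> q * excess n w"
          using l_gt_1_real by simp
        moreover have "log l a = 2 ^ j - log l (2 * C)"
          using C_ge_1 l_gt_1_real by (simp add: a_def log_divide)
        ultimately have "(2 ^ j - log l (2 * C)) / q \<le> excess n w"
          using q(1) by (simp add: pos_divide_le_eq mult.commute)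
        moreover have "(2 ^ j - log l (2 * C)) / q = (1 - log l (2 * C) / 2 ^ j) * \<theta> n"
          using \<theta>(1) by (simp add: q_def field_simps)
        ultimately show "w \<in> {w \<in> words n. (1 - log l (2 * C) / 2 ^ j) * \<theta> n \<le> excess n w}"
          using w by simp
      qed
    qed simp
    finally show ?case .
  qed
  then show ?thesis
    using a b by (intro exI[of _ "a\<^sup>2 / b"]) simp
qed

lemma excess_append_ge:
  assumes "u \<in> words p" "v \<in> words n" "0 < \<mu> u" "0 < \<mu> v"
  shows "excess n v - log l C - p * d \<le> excess (p + n) (u @ v)"
proof -
  have "0 < 1 / C * \<mu> u * \<mu> v"
    using assms C_ge_1 by simp
  then have pos: "0 < \<mu> (u @ v)"
    using quasi_lower[of u v] words_adic assms by (meson less_le_trans)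
  have "log l (\<mu> (u @ v)) \<le> log l (C * \<mu> u * \<mu> v)"
    using quasi_upper[of u v] words_adic assms pos l_gt_1_real C_ge_1
    by (subst log_le_cancel_iff) auto
  also have "\<dots> = log l C + log l (\<mu> u) + log l (\<mu> v)"
    using assms C_ge_1 l_gt_1_real by (simp add: log_mult)
  also have "log l (\<mu> u) \<le> 0"
    using assms l_gt_1_real by simp
  finally show ?thesis
    by (simp add: excess_def algebra_simps)
qed

text \<open>Inside the cube coded by \<open>u\<close>, the measure looks like the whole measure up to the factor \<open>C\<close>. The
  prefix lowers the excess by at most a bounded amount and shifts \<open>n\<close> to \<open>p + n\<close>; both are
  absorbed for large \<open>n\<close> by the gap between \<open>b\<close> and \<open>1 - log l (2 C) / 2 ^ j\<close>. The proportion
  \<open>\<delta>\<close> does not depend on \<open>u\<close>, only the generation from which on the estimate holds does.\<close>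

lemma heavy_words_in_cube:
  assumes b: "0 \<le> b" "b < 1"
  shows "\<exists>\<delta>>0. \<forall>p. \<forall>u\<in>words p. \<forall>\<^sub>F n in sequentially.
    \<delta> * \<mu> u \<le> (\<Sum>v | v \<in> words n \<and> b * \<theta> (real (p + n)) \<le> excess (p + n) (u @ v). \<mu> (u @ v))"
proof -
  define k where "k = log l (2 * C)"
  \<comment> \<open>\<open>j\<close> is so large that the loss \<open>k / 2 ^ j\<close> stays below \<open>1 - b\<close>\<close>
  obtain j :: nat where "k / (1 - b) < 2 ^ j"
    using real_arch_pow[of 2 "k / (1 - b)"] by auto
  then have "k < (1 - b) * 2 ^ j"
    using b by (simp add: pos_divide_less_eq mult.commute)
  then have "k / 2 ^ j < 1 - b"
    by (simp add: pos_divide_less_eq)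
  then have g: "b < 1 - k / 2 ^ j"
    by simp
  obtain \<delta> where \<delta>: "0 < \<delta>" and heavy: "\<forall>\<^sub>F n in sequentially.
      \<delta> \<le> (\<Sum>w | w \<in> words n \<and> (1 - k / 2 ^ j) * \<theta> n \<le> excess n w. \<mu> w)"
    using heavy_words[of j] unfolding k_def by blast
  have "\<forall>\<^sub>F n in sequentially. \<delta> / C * \<mu> u
      \<le> (\<Sum>v | v \<in> words n \<and> b * \<theta> (real (p + n)) \<le> excess (p + n) (u @ v). \<mu> (u @ v))"
    if u: "u \<in> words p" for p u
  proof (cases "\<mu> u = 0")
    case False
    then have \<mu>_u: "0 < \<mu> u"
      by (simp add: zero_less_measure_iff)
    define g where "g = 1 - k / 2 ^ j - b"
    have "0 < g"
      using \<open>b < 1 - k / 2 ^ j\<close> by (simp add: g_def)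
    have "\<forall>\<^sub>F n in sequentially. 2 * b * p / g \<le> real n"
      "\<forall>\<^sub>F n in sequentially. 2 * (log l C + p * d) / g \<le> \<theta> (real n)"
      using filterlim_real_sequentially theta_at_top unfolding filterlim_at_top by blast+
    then show ?thesis
      using heavy eventually_t\<^sub>0
    proof eventually_elim
      case (elim n)
      have n: "0 < real n" and \<theta>: "2 \<le> \<theta> n"
        using elim(4) t\<^sub>0_pos theta_spec(1)[OF elim(4)] by auto
      have shift: "b * \<theta> (real (p + n)) \<le> (1 - k / 2 ^ j) * \<theta> n - log l C - p * d"
      proof -
        have "\<theta> (real (p + n)) \<le> (n + p) / n * \<theta> n"
          using theta_add_le[OF elim(4), of "real p"] by (simp add: add.commute)
        then have "b * \<theta> (real (p + n)) \<le> b * ((n + p) / n * \<theta> n)"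
          using b by (intro mult_left_mono) auto
        also have "\<dots> = b * \<theta> n + b * p / n * \<theta> n"
          using n by (simp add: field_simps)
        also have "b * p / n * \<theta> n \<le> g / 2 * \<theta> n"
          using elim(1) n \<theta> \<open>0 < g\<close> by (intro mult_right_mono) (auto simp: field_simps)
        also have "log l C + p * d \<le> g / 2 * \<theta> n"
          using elim(2) \<open>0 < g\<close> by (simp add: field_simps)
        then have "b * \<theta> n + g / 2 * \<theta> n \<le> b * \<theta> n + g * \<theta> n - log l C - p * d"
          by simp
        also have "b * \<theta> n + g * \<theta> n = (1 - k / 2 ^ j) * \<theta> n"
          by (simp add: g_def algebra_simps)
        finally show ?thesis
          by simp
      qed
      define T where "T = {v \<in> words n. (1 - k / 2 ^ j) * \<theta> n \<le> excess n v}"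
      \<comment> \<open>words of mass 0 are discarded, as their excess is an artefact of \<open>log l 0 = 0\<close>\<close>
      define T' where "T' = {v \<in> T. 0 < \<mu> v}"
      have T: "finite T" "finite T'" "T' \<subseteq> T"
        using finite_words by (auto simp: T_def T'_def)
      have "\<delta> / C * \<mu> u \<le> 1 / C * \<mu> u * (\<Sum>v\<in>T. \<mu> v)"
        using mult_right_mono[OF elim(3), of "1 / C * \<mu> u"] \<mu>_u C_ge_1
        by (simp add: T_def mult_ac)
      also have "(\<Sum>v\<in>T. \<mu> v) = (\<Sum>v\<in>T'. \<mu> v)"
        using T by (intro sum.mono_neutral_right) (auto simp: T'_def zero_less_measure_iff)
      also have "1 / C * \<mu> u * \<dots> = (\<Sum>v\<in>T'. 1 / C * \<mu> u * \<mu> v)"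
        by (simp add: sum_distrib_left)
      also have "\<dots> \<le> (\<Sum>v\<in>T'. \<mu> (u @ v))"
        using u words_adic by (intro sum_mono quasi_lower) (auto simp: T'_def T_def)
      also have "\<dots> \<le> (\<Sum>v | v \<in> words n \<and> b * \<theta> (real (p + n)) \<le> excess (p + n) (u @ v). \<mu> (u @ v))"
      proof (rule sum_mono2)
        show "T' \<subseteq> {v \<in> words n. b * \<theta> (real (p + n)) \<le> excess (p + n) (u @ v)}"
        proof
          fix v assume "v \<in> T'"
          then have "v \<in> words n" "0 < \<mu> v" "(1 - k / 2 ^ j) * \<theta> n \<le> excess n v"
            by (auto simp: T'_def T_def)
          then show "v \<in> {v \<in> words n. b * \<theta> (real (p + n)) \<le> excess (p + n) (u @ v)}"
            using excess_append_ge[OF u, of v n] \<mu>_u shift by simp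
        qed
      qed (use finite_words in auto)
      finally show ?case .
    qed
  qed (simp add: sum_nonneg)
  then show ?thesis
    using \<delta> C_ge_1 by (intro exI[of _ "\<delta> / C"]) auto
qed

text \<open>The set of points with \<open>S_n - n d \<ge> b \<theta> n\<close>, written as a finite union of cubes. The excess is
  heavy here; the cubes themselves are light.\<close>

definition heavy :: "nat \<Rightarrow> real \<Rightarrow> (real ^ 'n) set" where
  "heavy n b = (\<Union>w\<in>{w \<in> words n. b * \<theta> n \<le> excess n w}. c w)"

lemma heavy_sets: "heavy n b \<in> sets m"
  unfolding heavy_def by (rule UN_cubes_sets[of _ n]) auto

lemma measure_cube_heavy_ge:
  assumes u: "u \<in> words p"
  shows "(\<Sum>v | v \<in> words n \<and> b * \<theta> (real (p + n)) \<le> excess (p + n) (u @ v). \<mu> (u @ v))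
    \<le> measure m (c u \<inter> heavy (p + n) b)"
proof -
  define T where "T = {v \<in> words n. b * \<theta> (real (p + n)) \<le> excess (p + n) (u @ v)}"
  have T: "(@) u ` T \<subseteq> words (p + n)"
    using append_words[OF u] by (auto simp: T_def)
  have "(\<Sum>v\<in>T. \<mu> (u @ v)) = (\<Sum>w\<in>(@) u ` T. \<mu> w)"
    by (subst sum.reindex) (auto simp: inj_on_def)
  also have "\<dots> = measure m (\<Union>w\<in>(@) u ` T. c w)"
    by (rule measure_UN_cubes[OF T, symmetric])
  also have "\<dots> \<le> measure m (c u \<inter> heavy (p + n) b)"
  proof (rule finite_measure_mono)
    show "(\<Union>w\<in>(@) u ` T. c w) \<subseteq> c u \<inter> heavy (p + n) b"
    proof
      fix x assume "x \<in> (\<Union>w\<in>(@) u ` T. c w)"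
      then obtain v where v: "v \<in> T" "x \<in> c (u @ v)"
        by auto
      have uv: "u @ v \<in> words (p + n)"
        using T v by auto
      then have "x \<in> c u"
        using cube_append_subset[of u v] words_adic v by blast
      then show "x \<in> c u \<inter> heavy (p + n) b"
        using v uv by (auto simp: heavy_def T_def)
    qed
  qed (use u cube_sets heavy_sets in auto)
  finally show ?thesis
    by (simp add: T_def)
qed

lemma AE_frequently_heavy:
  assumes b: "0 \<le> b" "b < 1"
  shows "AE x in m. \<exists>\<^sub>F n in sequentially. x \<in> heavy n b"
proof -
  obtain \<delta> where \<delta>: "0 < \<delta>" and local: "\<And>p u. u \<in> words p \<Longrightarrow> \<forall>\<^sub>F n in sequentially.
    \<delta> * \<mu> u \<le> (\<Sum>v | v \<in> words n \<and> b * \<theta> (real (p + n)) \<le> excess (p + n) (u @ v). \<mu> (u @ v))"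
    using heavy_words_in_cube[OF b] by blast
  have "AE x in m. x \<in> (\<Union>n\<in>{N..}. heavy n b)" for N
  proof (rule AE_if_dense_in_cubes[OF _ \<delta>])
    show B: "(\<Union>n\<in>{N..}. heavy n b) \<in> sets m"
      using heavy_sets by (intro sets.countable_UN') auto
    fix p u assume u: "u \<in> words p"
    have "\<forall>\<^sub>F n in sequentially. \<delta> * \<mu> u \<le> measure m (c u \<inter> heavy (p + n) b)"
      using local[OF u] by (rule eventually_mono) (rule order_trans[OF _ measure_cube_heavy_ge[OF u]])
    then obtain n where n: "N \<le> n" "\<delta> * \<mu> u \<le> measure m (c u \<inter> heavy (p + n) b)"
      unfolding eventually_sequentially using nle_le by blast
    note n(2)
    also have "measure m (c u \<inter> heavy (p + n) b) \<le> measure m (c u \<inter> (\<Union>n\<in>{N..}. heavy n b))"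
      using n(1) B cube_sets[OF u]
      by (intro finite_measure_mono) (auto intro!: bexI[of _ "p + n"])
    finally show "\<delta> * \<mu> u \<le> measure m (c u \<inter> (\<Union>n\<in>{N..}. heavy n b))" .
  qed
  then have "AE x in m. \<forall>N. x \<in> (\<Union>n\<in>{N..}. heavy n b)"
    by (simp add: AE_all_countable)
  then show ?thesis
    by (rule AE_mp) (auto simp: frequently_sequentially)
qed

lemma heavy_imp_S_n:
  assumes "x \<in> heavy n b"
  shows "b * \<theta> n \<le> S_n l m n x - n * d"
proof -
  obtain w where w: "w \<in> words n" "b * \<theta> n \<le> excess n w" "x \<in> c w"
    using assms by (auto simp: heavy_def)
  then show ?thesis
    by (simp add: S_n_def excess_def cube_at_eq[OF w(1,3)])
qed

lemma AE_limsup_ge_1: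
  "AE x in m. 1 \<le> limsup (\<lambda>n. ereal ((S_n l m n x - real n * d) / \<theta> (real n)))"
proof -
  have "AE x in m. \<forall>k. \<exists>\<^sub>F n in sequentially. x \<in> heavy n (1 - 1 / real (Suc k))"
    unfolding AE_all_countable by (intro allI AE_frequently_heavy) auto
  then show ?thesis
  proof (rule AE_mp, intro AE_I2 impI)
    fix x assume x: "\<forall>k. \<exists>\<^sub>F n in sequentially. x \<in> heavy n (1 - 1 / real (Suc k))"
    let ?f = "\<lambda>n. ereal ((S_n l m n x - real n * d) / \<theta> (real n))"
    have ge: "ereal (1 - 1 / real (Suc k)) \<le> limsup ?f" for k
    proof (rule ccontr)
      assume "\<not> ?thesis"
      then have "\<forall>\<^sub>F n in sequentially. ?f n < ereal (1 - 1 / real (Suc k))"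
        by (intro Limsup_lessD) simp
      then have "\<forall>\<^sub>F n in sequentially. x \<notin> heavy n (1 - 1 / real (Suc k))"
        using eventually_t\<^sub>0
      proof eventually_elim
        case (elim n)
        have "0 < \<theta> (real n)"
          using theta_spec(1)[OF elim(2)] by simp
        then show ?case
          using elim(1) heavy_imp_S_n[of x n] by (fastforce simp: pos_divide_less_eq)
      qed
      then show False
        using x by (simp add: frequently_def)
    qed
    have "(\<lambda>k. ereal (1 - 1 / real (Suc k))) \<longlonglongrightarrow> ereal (1 - 0)"
      by (intro tendsto_intros lim_ereal[THEN iffD2] LIMSEQ_Suc[OF lim_1_over_n])
    then have "ereal (1 - 0) \<le> limsup ?f"
      by (rule LIMSEQ_le_const2) (use ge in blast)
    then show "1 \<le> limsup ?f"
      by (simp add: one_ereal_def)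
  qed
qed

lemma frequently_at_right_if_frequently_powers:
  assumes "\<exists>\<^sub>F n in sequentially. P (1 / (2 * real l ^ n))"
  shows "\<exists>\<^sub>F r in at_right 0. P r"
proof (rule ccontr)
  assume "\<not> ?thesis"
  then have "\<forall>\<^sub>F r in at_right 0. \<not> P r"
    by (simp add: frequently_def)
  moreover have "filterlim (\<lambda>n. 1 / (2 * real l ^ n)) (at_right 0) sequentially"
  proof (rule tendsto_imp_filterlim_at_right)
    have "(\<lambda>n. 1 / 2 * (1 / real l) ^ n) \<longlonglongrightarrow> 1 / 2 * 0"
      using l_gt_1_real by (intro tendsto_mult_left LIMSEQ_realpow_zero) auto
    then show "(\<lambda>n. 1 / (2 * real l ^ n)) \<longlonglongrightarrow> 0"
      by (simp add: power_divide)
  qed (use l_gt_1_real in simp)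
  ultimately have "\<forall>\<^sub>F n in sequentially. \<not> P (1 / (2 * real l ^ n))"
    by (rule eventually_compose_filterlim)
  then show False
    using assms by (simp add: frequently_def)
qed

lemma psi_power: "psi l m a (1 / real l ^ n) = l powr (- n * d - a * \<theta> n)"
proof -
  have "log l (1 / (1 / real l ^ n)) = n"
    using l_gt_1_real by (simp add: log_nat_power)
  moreover have "(1 / real l ^ n) powr d = l powr (- n * d)"
    using l_gt_1_real by (simp add: powr_divide powr_realpow[symmetric] powr_powr powr_minus_divide)
  ultimately show ?thesis
    by (simp add: psi_def powr_add[symmetric])
qed

text \<open>Points that lie infinitely often in a heavy cube, with \<open>b\<close> halfway between \<open>a\<close> and 1, have balls
  of mass at most \<open>n\<^sup>2 l powr (- n d - b \<theta> n)\<close> infinitely often. The factor \<open>n\<^sup>2\<close> is at most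
  \<open>l powr ((b - a) \<theta> n)\<close>. Recording \<open>t\<^sub>0 \<le> n\<close> keeps \<open>\<theta> n\<close> positive, which the comparison of
  \<open>\<psi>\<^sub>a\<close> with the power gauge uses.\<close>

lemma AE_frequently_ball_light:
  assumes a: "0 < a" "a < 1"
  shows "AE x in m. \<exists>\<^sub>F n in sequentially. t\<^sub>0 \<le> real n \<and>
    measure m (cball x (5 / (2 * real l ^ n)) \<inter> unit_box) \<le> psi l m a (1 / real l ^ n)"
proof -
  define b where "b = (1 + a) / 2"
  have b: "0 \<le> b" "b < 1" "0 < b - a"
    using a by (auto simp: b_def field_simps)
  show ?thesis
    using AE_frequently_heavy[OF b(1,2)] AE_eventually_ball_le_cube
  proof eventually_elim
    case (elim x)
    have "\<forall>\<^sub>F n in sequentially. 1 \<le> n \<and> t\<^sub>0 \<le> real n \<and> 2 * log l (real n) \<le> (b - a) * \<theta> (real n) \<and>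
        measure m (cball x (5 / (2 * real l ^ n)) \<inter> unit_box) \<le> (real n)\<^sup>2 * measure m (cube_at l n x)"
      using eventually_ge_at_top[of 1] eventually_t\<^sub>0 log_le_theta[OF b(3)] elim(2)
      by eventually_elim auto
    with elim(1) have "\<exists>\<^sub>F n in sequentially. (1 \<le> n \<and> t\<^sub>0 \<le> real n \<and>
        2 * log l (real n) \<le> (b - a) * \<theta> (real n) \<and>
        measure m (cball x (5 / (2 * real l ^ n)) \<inter> unit_box) \<le> (real n)\<^sup>2 * measure m (cube_at l n x)) \<and>
        x \<in> heavy n b"
      by (rule frequently_eventually_conj)
    then show ?case
    proof (rule frequently_elim1)
      fix n assume n: "(1 \<le> n \<and> t\<^sub>0 \<le> real n \<and>
        2 * log l (real n) \<le> (b - a) * \<theta> (real n) \<and>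
        measure m (cball x (5 / (2 * real l ^ n)) \<inter> unit_box) \<le> (real n)\<^sup>2 * measure m (cube_at l n x)) \<and>
        x \<in> heavy n b"
      define M where "M = measure m (cube_at l n x)"
      have M: "M \<le> l powr (- n * d - b * \<theta> n)"
      proof (cases "M = 0")
        case False
        then have "0 < M"
          by (simp add: M_def zero_less_measure_iff)
        then have "M = l powr (log l M)"
          using l_gt_1_real by simp
        also have "\<dots> \<le> l powr (- n * d - b * \<theta> n)"
          using heavy_imp_S_n[of x n b] n l_gt_1_real by (simp add: S_n_def M_def)
        finally show ?thesis .
      qed simp
      have "(real n)\<^sup>2 = l powr (2 * log l (real n))"
      proof -
        have "l powr (2 * log l (real n)) = (l powr log l (real n)) ^ 2"
          by (simp add: power2_eq_square flip: powr_add)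
        then show ?thesis
          using n l_gt_1_real by simp
      qed
      also have "\<dots> \<le> l powr ((b - a) * \<theta> n)"
        using n l_gt_1_real by simp
      finally have square: "(real n)\<^sup>2 \<le> l powr ((b - a) * \<theta> n)" .
      have "measure m (cball x (5 / (2 * real l ^ n)) \<inter> unit_box) \<le> (real n)\<^sup>2 * M"
        using n by (simp add: M_def)
      also have "\<dots> \<le> l powr ((b - a) * \<theta> n) * l powr (- n * d - b * \<theta> n)"
        using square M by (intro mult_mono) (auto simp: M_def)
      also have "\<dots> = psi l m a (1 / real l ^ n)"
        unfolding psi_power by (simp add: algebra_simps flip: powr_add)
      finally show "t\<^sub>0 \<le> real n \<and>
          measure m (cball x (5 / (2 * real l ^ n)) \<inter> unit_box) \<le> psi l m a (1 / real l ^ n)"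
        using n by simp
    qed
  qed
qed

lemma abs_cont_packing_if_frequently_light:
  assumes "AE x in m. \<exists>\<^sub>F n in sequentially.
    measure m (cball x (5 / (2 * real l ^ n)) \<inter> unit_box) \<le> \<Psi> (1 / real l ^ n)"
  shows "abs_cont_packing m \<Psi>"
proof (rule abs_cont_packing_if_balls_frequently_light[OF sets_m])
  show "AE x in m. \<exists>\<^sub>F r in at_right 0.
      emeasure m (cball x (5 * r) \<inter> unit_box) \<le> ennreal (\<Psi> (2 * r))"
    using assms
  proof eventually_elim
    case (elim x)
    show ?case
    proof (rule frequently_at_right_if_frequently_powers, rule frequently_elim1[OF elim])
      fix n assume "measure m (cball x (5 / (2 * real l ^ n)) \<inter> unit_box) \<le> \<Psi> (1 / real l ^ n)"
      then show "emeasure m (cball x (5 * (1 / (2 * real l ^ n))) \<inter> unit_box)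
          \<le> ennreal (\<Psi> (2 * (1 / (2 * real l ^ n))))"
        by (simp add: emeasure_eq_measure ennreal_leI)
    qed
  qed
qed

lemma abs_cont_packing_psi:
  assumes "0 < a" "a < 1"
  shows "abs_cont_packing m (psi l m a)"
proof (rule abs_cont_packing_if_frequently_light)
  show "AE x in m. \<exists>\<^sub>F n in sequentially.
      measure m (cball x (5 / (2 * real l ^ n)) \<inter> unit_box) \<le> psi l m a (1 / real l ^ n)"
    using AE_frequently_ball_light[OF assms]
    by eventually_elim (auto elim: frequently_elim1)
qed

lemma abs_cont_packing_power: "abs_cont_packing m (\<lambda>t. t powr d)"
proof (rule abs_cont_packing_if_frequently_light)
  have half: "0 < (1 / 2 :: real)" "(1 / 2 :: real) < 1"
    by auto
  have psi_le: "psi l m (1 / 2) (1 / real l ^ n) \<le> (1 / real l ^ n) powr d" if "t\<^sub>0 \<le> real n" for n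
  proof -
    have "l powr (- n * d - 1 / 2 * \<theta> n) \<le> l powr (- n * d)"
      using theta_spec(1)[OF that] l_gt_1_real by simp
    also have "\<dots> = (1 / real l ^ n) powr d"
      using l_gt_1_real
      by (simp add: powr_divide powr_realpow[symmetric] powr_powr powr_minus_divide)
    finally show ?thesis
      by (simp add: psi_power)
  qed
  show "AE x in m. \<exists>\<^sub>F n in sequentially.
      measure m (cball x (5 / (2 * real l ^ n)) \<inter> unit_box) \<le> (1 / real l ^ n) powr d"
    using AE_frequently_ball_light[OF half]
    by eventually_elim (auto elim!: frequently_elim1 intro: order_trans[OF _ psi_le])
qed

end

theorem theorem4p10:
  fixes l :: nat and c :: "nat list \<Rightarrow> (real ^ 'n) set" and m :: "(real ^ 'n) measure"
  assumes "l \<ge> 2" and "adic_coding l c" and "quasi_Bernoulli l c m"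
    and "\<exists>C>0. \<forall>q. 0 < q \<and> q \<le> 1 \<longrightarrow> 0 < chi l m q \<and> chi l m q \<le> C * chi l m (q / 2)"
  shows "(AE x in m.
           limsup (\<lambda>n. ereal ((S_n l m n x - real n * qB_dim l m) / theta l m (real n))) \<ge> 1) \<and>
         (\<forall>a. 0 < a \<and> a < 1 \<longrightarrow> abs_cont_packing m (psi l m a)) \<and>
         abs_cont_packing m (\<lambda>t. t powr qB_dim l m)"
proof -
  obtain C where C: "1 \<le> C"
    "\<forall>u \<in> adic_words CARD('n) l. \<forall>v \<in> adic_words CARD('n) l.
        1 / C * measure m (c u) * measure m (c v) \<le> measure m (c (u @ v)) \<and>
        measure m (c (u @ v)) \<le> C * measure m (c u) * measure m (c v)"
    using assms(3) unfolding quasi_Bernoulli_def by blast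
  obtain K where K: "\<forall>q. 0 < q \<and> q \<le> 1 \<longrightarrow> 0 < chi l m q \<and> chi l m q \<le> K * chi l m (q / 2)"
    using assms(4) by blast
  interpret prob_space m
    using assms(3) by (simp add: quasi_Bernoulli_def)
  interpret chi_doubling m l c C K
  proof
    show "sets m = sets (restrict_space borel unit_box)"
      using assms(3) by (simp add: quasi_Bernoulli_def)
  qed (use assms(1,2) C K in auto)
  show ?thesis
    using AE_limsup_ge_1 abs_cont_packing_psi abs_cont_packing_power by blast
qed

end
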